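(* Let $\mathfrak g$ be a simple Lie algebra over an algebraically closed field of characteristic $0$ with Cartan subalgebra $\mathfrak h$, root system $\Delta$ and Weyl group $W$. Let $w\in W$ be a quasiregular element of order $m$, and suppose $w$ has a lift $\sigma$ of the same order $m$ in the normalizer of $\mathfrak h$ in the adjoint group of $\mathfrak g$. Then $$\frac{|\Delta|}{m}=\dim\mathfrak g^{\sigma}-\dim\mathfrak h^{w},$$ where $\mathfrak g^\sigma$ is the fixed point set of $\sigma$ in $\mathfrak g$ and $\mathfrak h^w$ the fixed point set of $w$ in $\mathfrak h$.
   Context: An element $w\in W$ of order $m$ is quasiregular if for every divisor $s$ of $m$ with $s<m$, the element $w^s$ fixes no root. A lift of $w$ is an element of the normalizer of $\mathfrak h$ in the adjoint group whose induced action on $\mathfrak h$ is $w$. *)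

theory Defs
  imports Main "HOL-Computational_Algebra.Polynomial"
begin

text \<open>A Lie algebra is modelled as the whole type 'v, a vector space over the
field 'k with scalar multiplication smul, equipped with a bracket br.\<close>

definition alg_closed_field :: "'k::field itself \<Rightarrow> bool" where
  "alg_closed_field _ \<longleftrightarrow> (\<forall>p::'k poly. degree p > 0 \<longrightarrow> (\<exists>x. poly p x = 0))"

definition fin_dim :: "('k::field \<Rightarrow> 'v::ab_group_add \<Rightarrow> 'v) \<Rightarrow> bool" where
  "fin_dim smul \<longleftrightarrow> (\<exists>B. finite B \<and> module.span smul B = UNIV)"

definition lie_algebra :: "('k::field \<Rightarrow> 'v::ab_group_add \<Rightarrow> 'v) \<Rightarrow> ('v \<Rightarrow> 'v \<Rightarrow> 'v) \<Rightarrow> bool" where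
  "lie_algebra smul br \<longleftrightarrow> vector_space smul \<and>
     (\<forall>x y z. br (x + y) z = br x z + br y z) \<and>
     (\<forall>x y z. br x (y + z) = br x y + br x z) \<and>
     (\<forall>a x y. br (smul a x) y = smul a (br x y)) \<and>
     (\<forall>a x y. br x (smul a y) = smul a (br x y)) \<and>
     (\<forall>x. br x x = 0) \<and>
     (\<forall>x y z. br x (br y z) + br y (br z x) + br z (br x y) = 0)"

definition lie_ideal :: "('k::field \<Rightarrow> 'v::ab_group_add \<Rightarrow> 'v) \<Rightarrow> ('v \<Rightarrow> 'v \<Rightarrow> 'v) \<Rightarrow> 'v set \<Rightarrow> bool" where
  "lie_ideal smul br I \<longleftrightarrow> module.subspace smul I \<and> (\<forall>x y. y \<in> I \<longrightarrow> br x y \<in> I)"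

definition simple_lie_algebra :: "('k::field \<Rightarrow> 'v::ab_group_add \<Rightarrow> 'v) \<Rightarrow> ('v \<Rightarrow> 'v \<Rightarrow> 'v) \<Rightarrow> bool" where
  "simple_lie_algebra smul br \<longleftrightarrow> lie_algebra smul br \<and> (\<exists>x y. br x y \<noteq> 0) \<and>
     (\<forall>I. lie_ideal smul br I \<longrightarrow> I = {0} \<or> I = UNIV)"

definition lie_subalgebra :: "('k::field \<Rightarrow> 'v::ab_group_add \<Rightarrow> 'v) \<Rightarrow> ('v \<Rightarrow> 'v \<Rightarrow> 'v) \<Rightarrow> 'v set \<Rightarrow> bool" where
  "lie_subalgebra smul br H \<longleftrightarrow> module.subspace smul H \<and> (\<forall>x\<in>H. \<forall>y\<in>H. br x y \<in> H)"

fun lcs :: "('k::field \<Rightarrow> 'v::ab_group_add \<Rightarrow> 'v) \<Rightarrow> ('v \<Rightarrow> 'v \<Rightarrow> 'v) \<Rightarrow> 'v set \<Rightarrow> nat \<Rightarrow> 'v set" where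
  "lcs smul br H 0 = H"
| "lcs smul br H (Suc n) = module.span smul {br x y | x y. x \<in> H \<and> y \<in> lcs smul br H n}"

definition nilpotent_subalgebra :: "('k::field \<Rightarrow> 'v::ab_group_add \<Rightarrow> 'v) \<Rightarrow> ('v \<Rightarrow> 'v \<Rightarrow> 'v) \<Rightarrow> 'v set \<Rightarrow> bool" where
  "nilpotent_subalgebra smul br H \<longleftrightarrow> lie_subalgebra smul br H \<and> (\<exists>n. lcs smul br H n = {0})"

definition cartan_subalgebra :: "('k::field \<Rightarrow> 'v::ab_group_add \<Rightarrow> 'v) \<Rightarrow> ('v \<Rightarrow> 'v \<Rightarrow> 'v) \<Rightarrow> 'v set \<Rightarrow> bool" where
  "cartan_subalgebra smul br H \<longleftrightarrow> nilpotent_subalgebra smul br H \<and>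
     {x. \<forall>y\<in>H. br x y \<in> H} = H"

definition root_space :: "('k::field \<Rightarrow> 'v::ab_group_add \<Rightarrow> 'v) \<Rightarrow> ('v \<Rightarrow> 'v \<Rightarrow> 'v) \<Rightarrow> 'v set \<Rightarrow> ('v \<Rightarrow> 'k) \<Rightarrow> 'v set" where
  "root_space smul br H \<alpha> = {x. \<forall>y\<in>H. br y x = smul (\<alpha> y) x}"

definition roots :: "('k::field \<Rightarrow> 'v::ab_group_add \<Rightarrow> 'v) \<Rightarrow> ('v \<Rightarrow> 'v \<Rightarrow> 'v) \<Rightarrow> 'v set \<Rightarrow> ('v \<Rightarrow> 'k) set" where
  "roots smul br H = {\<alpha>.
     (\<forall>x. x \<notin> H \<longrightarrow> \<alpha> x = 0) \<and>
     (\<forall>x\<in>H. \<forall>y\<in>H. \<alpha> (x + y) = \<alpha> x + \<alpha> y) \<and>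
     (\<forall>a. \<forall>x\<in>H. \<alpha> (smul a x) = a * \<alpha> x) \<and>
     (\<exists>x\<in>H. \<alpha> x \<noteq> 0) \<and>
     root_space smul br H \<alpha> \<noteq> {0}}"

definition nilpotent_map :: "('v::ab_group_add \<Rightarrow> 'v) \<Rightarrow> bool" where
  "nilpotent_map f \<longleftrightarrow> (\<exists>n. f ^^ n = (\<lambda>_. 0))"

definition exp_map :: "('k::field_char_0 \<Rightarrow> 'v::ab_group_add \<Rightarrow> 'v) \<Rightarrow> ('v \<Rightarrow> 'v) \<Rightarrow> 'v \<Rightarrow> 'v" where
  "exp_map smul f = (\<lambda>v. \<Sum>k < (LEAST n. f ^^ n = (\<lambda>_. 0)).
       smul (inverse (of_nat (fact k))) ((f ^^ k) v))"

inductive_set adjoint_group :: "('k::field_char_0 \<Rightarrow> 'v::ab_group_add \<Rightarrow> 'v) \<Rightarrow> ('v \<Rightarrow> 'v \<Rightarrow> 'v) \<Rightarrow> ('v \<Rightarrow> 'v) set"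
  for smul br where
  adj_id: "id \<in> adjoint_group smul br"
| adj_step: "nilpotent_map (br x) \<Longrightarrow> \<sigma> \<in> adjoint_group smul br \<Longrightarrow>
     exp_map smul (br x) \<circ> \<sigma> \<in> adjoint_group smul br"

definition normalizer_adj :: "('k::field_char_0 \<Rightarrow> 'v::ab_group_add \<Rightarrow> 'v) \<Rightarrow> ('v \<Rightarrow> 'v \<Rightarrow> 'v) \<Rightarrow> 'v set \<Rightarrow> ('v \<Rightarrow> 'v) set" where
  "normalizer_adj smul br H = {\<sigma> \<in> adjoint_group smul br. \<sigma> ` H = H}"

definition restr_H :: "'v set \<Rightarrow> ('v \<Rightarrow> 'v) \<Rightarrow> 'v \<Rightarrow> 'v" where
  "restr_H H \<sigma> = (\<lambda>x. if x \<in> H then \<sigma> x else x)"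

text \<open>Weyl group W = N(H)/C(H), realised as the induced maps on H.\<close>
definition weyl_group :: "('k::field_char_0 \<Rightarrow> 'v::ab_group_add \<Rightarrow> 'v) \<Rightarrow> ('v \<Rightarrow> 'v \<Rightarrow> 'v) \<Rightarrow> 'v set \<Rightarrow> ('v \<Rightarrow> 'v) set" where
  "weyl_group smul br H = restr_H H ` normalizer_adj smul br H"

definition is_lift :: "('k::field_char_0 \<Rightarrow> 'v::ab_group_add \<Rightarrow> 'v) \<Rightarrow> ('v \<Rightarrow> 'v \<Rightarrow> 'v) \<Rightarrow> 'v set \<Rightarrow> ('v \<Rightarrow> 'v) \<Rightarrow> ('v \<Rightarrow> 'v) \<Rightarrow> bool" where
  "is_lift smul br H w \<sigma> \<longleftrightarrow> \<sigma> \<in> normalizer_adj smul br H \<and> restr_H H \<sigma> = w"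

definition has_order :: "('a \<Rightarrow> 'a) \<Rightarrow> nat \<Rightarrow> bool" where
  "has_order f m \<longleftrightarrow> 0 < m \<and> f ^^ m = id \<and> (\<forall>n. 0 < n \<and> n < m \<longrightarrow> f ^^ n \<noteq> id)"

text \<open>w fixes the root alpha iff alpha composed with w equals alpha.\<close>
definition quasiregular :: "('k::field_char_0 \<Rightarrow> 'v::ab_group_add \<Rightarrow> 'v) \<Rightarrow> ('v \<Rightarrow> 'v \<Rightarrow> 'v) \<Rightarrow> 'v set \<Rightarrow> ('v \<Rightarrow> 'v) \<Rightarrow> nat \<Rightarrow> bool" where
  "quasiregular smul br H w m \<longleftrightarrow>
     (\<forall>s. s dvd m \<and> s < m \<longrightarrow> (\<forall>\<alpha>\<in>roots smul br H. \<alpha> \<circ> (w ^^ s) \<noteq> \<alpha>))"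

end

(* By quasiregularity and gcd's, no power sigma^s with 0 < s < m fixes a root.  The operator
   (1/m) * sum_{s<m} sigma^s projects onto the fixed space of sigma, so m * dim g^sigma is the sum
   of the traces of the powers of sigma on g = H + (sum of the root spaces), and likewise
   m * dim H^w on H.  On the sum of the root spaces sigma^s permutes root lines without fixing
   any, hence has trace zero for 0 < s < m, while for s = 0 the trace is the number of roots because
   the root spaces are lines.

   The root space decomposition itself is obtained from traces only.  The generalized weight space
   of 0 is H by Engel's theorem and self-normalization.  The trace of [x, y] on an alpha-string
   vanishes when x and y have opposite weights, so every weight is a rational multiple of alpha
   at [x, y]; this gives Cartan's criterion, hence a nondegenerate Killing form.  One more
   vanishing trace, on k e + H + g_(-alpha) + g_(-2 alpha) + ..., shows that nonzero generalized
   weight spaces are one-dimensional. *)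

theory Submission
  imports Defs
begin

text \<open>A Cartan subalgebra is given only as nilpotent and self-normalizing, so neither its
  commutativity nor the diagonalizability of its adjoint action is available at the start. Weight
  spaces therefore have to be generalized eigenspaces, and even the linearity of a weight is a
  result: its value at h is the trace of \<open>ad h\<close> on the weight space divided by the
  dimension. In Cartan's criterion the field is not ordered, so positivity has no meaning in it;
  rationality of the ratios of weights at t = [x, y] turns the Killing form at t into a sum of
  rational squares times a square, and positivity is argued in the rationals. In the last trace
  argument k e must be stable under H, which requires a genuine common eigenvector e and not just a
  generalized one. Dimensions and cardinalities enter the field as traces, and characteristic 0
  allows them to be read back as natural numbers.\<close>

context finite_dimensional_vector_space
begin

section \<open>Linear endomorphisms and their iterates\<close>

abbreviation lin :: "('b \<Rightarrow> 'b) \<Rightarrow> bool" where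
  "lin f \<equiv> Vector_Spaces.linear scale scale f"

lemma linI:
  assumes "\<And>x y. f (x + y) = f x + f y" "\<And>a x. f (scale a x) = scale a (f x)"
  shows "lin f"
  using assms vector_space_axioms by (simp add: Vector_Spaces.linear_iff)

lemma lin_add: "lin f \<Longrightarrow> f (x + y) = f x + f y"
  by (simp add: Vector_Spaces.linear_iff)

lemma lin_scale: "lin f \<Longrightarrow> f (scale a x) = scale a (f x)"
  by (simp add: Vector_Spaces.linear_iff)

lemma lin_zero: "lin f \<Longrightarrow> f 0 = 0"
  using lin_scale[of f 0 0] by simp

lemma lin_diff: "lin f \<Longrightarrow> f (x - y) = f x - f y"
  using lin_add[of f "x - y" y] by (simp add: eq_diff_eq)

lemma lin_sum: "lin f \<Longrightarrow> f (sum g A) = (\<Sum>a\<in>A. f (g a))"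
  by (induction A rule: infinite_finite_induct) (simp_all add: lin_zero[of f] lin_add[of f])

lemma lin_id: "lin (\<lambda>v. v)"
  by (rule linI) auto

lemma lin_compose: "lin f \<Longrightarrow> lin g \<Longrightarrow> lin (\<lambda>v. f (g v))"
  by (rule linI) (simp_all add: lin_add[of f] lin_add[of g] lin_scale[of f] lin_scale[of g])

lemma lin_plus: "lin f \<Longrightarrow> lin g \<Longrightarrow> lin (\<lambda>v. f v + g v)"
  by (rule linI)
    (simp_all add: lin_add[of f] lin_add[of g] lin_scale[of f] lin_scale[of g] scale_right_distrib)

lemma lin_scaled: "lin f \<Longrightarrow> lin (\<lambda>v. scale c (f v))"
  by (rule linI) (simp_all add: lin_add[of f] lin_scale[of f] scale_right_distrib mult.commute)

lemma lin_minus: "lin f \<Longrightarrow> lin g \<Longrightarrow> lin (\<lambda>v. f v - g v)"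
  by (rule linI)
    (simp_all add: lin_add[of f] lin_add[of g] lin_scale[of f] lin_scale[of g] scale_right_diff_distrib)

lemma lin_zero_map: "lin (\<lambda>v. 0)"
  by (rule linI) auto

lemma lin_sum_maps: "(\<And>i. i \<in> I \<Longrightarrow> lin (f i)) \<Longrightarrow> lin (\<lambda>v. \<Sum>i\<in>I. f i v)"
proof (induction I rule: infinite_finite_induct)
  case (insert i I)
  then show ?case using lin_plus[of "f i" "\<lambda>v. \<Sum>i\<in>I. f i v"] by simp
qed (simp_all add: lin_zero_map)

lemma lin_funpow: "lin f \<Longrightarrow> lin (f ^^ n)"
proof (induction n)
  case 0
  then show ?case using lin_id by (simp add: id_def)
next
  case (Suc n)
  then show ?case using lin_compose[of f "f ^^ n"] by (simp add: o_def)
qed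

lemma lin_image_subspace:
  assumes f: "lin f" and V: "subspace V" shows "subspace (f ` V)"
proof (rule subspaceI)
  show "0 \<in> f ` V" using lin_zero[OF f] subspace_0[OF V] by force
  fix x y c assume "x \<in> f ` V"
  then obtain u where u: "u \<in> V" "x = f u" by blast
  then show "scale c x \<in> f ` V"
    using lin_scale[OF f, of c u] subspace_scale[OF V, of u c] by (metis imageI)
  assume "y \<in> f ` V"
  then obtain v where v: "v \<in> V" "y = f v" by blast
  then show "x + y \<in> f ` V"
    using u lin_add[OF f, of u v] subspace_add[OF V, of u v] by (metis imageI)
qed

lemma lin_vimage_subspace:
  assumes f: "lin f" and U: "subspace U" shows "subspace {v. f v \<in> U}"
  by (rule subspaceI)
    (auto simp: lin_zero[OF f] lin_add[OF f] lin_scale[OF f] subspace_0[OF U] subspace_add[OF U]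
      subspace_scale[OF U])

lemma lin_kernel_subspace: "lin f \<Longrightarrow> subspace {v. f v = 0}"
  using lin_vimage_subspace[of f "{0}"] by simp

lemma span_induct_lin:
  assumes "v \<in> span S" "subspace T" "\<And>x. x \<in> S \<Longrightarrow> x \<in> T"
  shows "v \<in> T"
  using assms span_minimal by blast

lemma lin_span_into:
  assumes "lin f" "\<And>x. x \<in> S \<Longrightarrow> f x \<in> U" "subspace U" "v \<in> span S"
  shows "f v \<in> U"
  using span_induct_lin[OF assms(4) lin_vimage_subspace[OF assms(1,3)]] assms(2) by blast

lemma funpow_inv: "(\<And>v. v \<in> V \<Longrightarrow> f v \<in> V) \<Longrightarrow> v \<in> V \<Longrightarrow> (f ^^ n) v \<in> V"
  by (induction n) auto

lemma funpow_zero_mono: "lin f \<Longrightarrow> (f ^^ n) v = 0 \<Longrightarrow> n \<le> k \<Longrightarrow> (f ^^ k) v = 0"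
proof -
  assume f: "lin f" "(f ^^ n) v = 0" "n \<le> k"
  have "(f ^^ k) v = (f ^^ (k - n)) ((f ^^ n) v)"
    using f(3) by (metis comp_apply diff_add_inverse2 funpow_add le_add_diff_inverse2)
  then show ?thesis using f lin_zero[OF lin_funpow[OF f(1)]] by simp
qed

lemma subspace_dim_less: "subspace V \<Longrightarrow> subspace W \<Longrightarrow> V \<subset> W \<Longrightarrow> dim V < dim W"
  by (intro dim_psubset) (simp add: span_eq_iff[THEN iffD2])

section \<open>Traces on invariant subspaces\<close>

definition basis_of :: "'b set \<Rightarrow> 'b set \<Rightarrow> bool" where
  "basis_of B V \<longleftrightarrow> independent B \<and> span B = V"

lemma basis_of_ex:
  assumes "subspace V" shows "\<exists>B. basis_of B V"
proof -
  obtain B where "B \<subseteq> V" "independent B" "V \<subseteq> span B" by (rule basis_exists)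
  then have "basis_of B V" using span_minimal[OF _ assms] unfolding basis_of_def by blast
  then show ?thesis by blast
qed

lemma basis_of_finite: "basis_of B V \<Longrightarrow> finite B"
  by (auto simp: basis_of_def intro: finiteI_independent)

lemma basis_of_subset: "basis_of B V \<Longrightarrow> b \<in> B \<Longrightarrow> b \<in> V"
  by (auto simp: basis_of_def intro: span_base)

lemma basis_of_card: "basis_of B V \<Longrightarrow> card B = dim V"
  by (metis basis_of_def dim_span_eq_card_independent)

text \<open>Maps are total on the ambient space, so the trace of a restriction is read off a chosen
  basis of the subspace; it has its usual meaning when the map preserves \<open>V\<close>.\<close>

definition trace :: "'b set \<Rightarrow> ('b \<Rightarrow> 'b) \<Rightarrow> 'a" where
  "trace V f = (let B = (SOME B. basis_of B V) in \<Sum>b\<in>B. representation B (f b) b)"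

lemma representation_lin:
  assumes B: "basis_of B V" and C: "basis_of C W" and g: "lin g"
    "\<And>w. w \<in> W \<Longrightarrow> g w \<in> V" and y: "y \<in> W"
  shows "representation B (g y) b = (\<Sum>c\<in>C. representation C y c * representation B (g c) b)"
proof -
  have "y = (\<Sum>c\<in>C. scale (representation C y c) c)"
    using C y basis_of_finite[OF C] by (auto simp: basis_of_def intro: sum_representation_eq[symmetric])
  from arg_cong[OF this, of g] have "g y = (\<Sum>c\<in>C. scale (representation C y c) (g c))"
    by (simp only: lin_sum[OF g(1)] lin_scale[OF g(1)])
  moreover have gB: "g c \<in> span B" if "c \<in> C" for c
    using B g(2) basis_of_subset[OF C that] by (simp add: basis_of_def)
  moreover have ind: "independent B" using B by (simp add: basis_of_def)
  ultimately show ?thesis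
    by (simp add: representation_sum[OF ind] representation_scale[OF ind] span_scale)
qed

text \<open>Both sides are the same double sum of products of matrix entries. Allowing two spaces
  pays off: \<open>f\<close> the identity gives independence of the basis, and \<open>g\<close> an
  inclusion lets the trace be computed on any subspace containing the image.\<close>

lemma trace_swap_bases:
  assumes B: "basis_of B V" and C: "basis_of C W"
    and f: "lin f" "\<And>v. v \<in> V \<Longrightarrow> f v \<in> W" and g: "lin g" "\<And>w. w \<in> W \<Longrightarrow> g w \<in> V"
  shows "(\<Sum>b\<in>B. representation B (g (f b)) b) = (\<Sum>c\<in>C. representation C (f (g c)) c)"
proof -
  have "(\<Sum>b\<in>B. representation B (g (f b)) b)
      = (\<Sum>b\<in>B. \<Sum>c\<in>C. representation C (f b) c * representation B (g c) b)"
    by (rule sum.cong) (auto simp: representation_lin[OF B C g] f(2) basis_of_subset[OF B])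
  also have "\<dots> = (\<Sum>c\<in>C. \<Sum>b\<in>B. representation B (g c) b * representation C (f b) c)"
    by (subst sum.swap) (simp add: mult.commute)
  also have "\<dots> = (\<Sum>c\<in>C. representation C (f (g c)) c)"
    by (rule sum.cong) (auto simp: representation_lin[OF C B f] g(2) basis_of_subset[OF C])
  finally show ?thesis .
qed

lemma trace_basis:
  assumes B: "basis_of B V" and f: "lin f" "\<And>v. v \<in> V \<Longrightarrow> f v \<in> V"
  shows "trace V f = (\<Sum>b\<in>B. representation B (f b) b)"
proof -
  have C: "basis_of (SOME B. basis_of B V) V" using B by (rule someI)
  show ?thesis
    using trace_swap_bases[OF C B lin_id _ f] by (simp add: trace_def)
qed

lemma trace_swap:
  assumes "subspace V" "subspace W"
    and f: "lin f" "\<And>v. v \<in> V \<Longrightarrow> f v \<in> W" and g: "lin g" "\<And>w. w \<in> W \<Longrightarrow> g w \<in> V"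
  shows "trace V (\<lambda>v. g (f v)) = trace W (\<lambda>v. f (g v))"
proof -
  obtain B C where B: "basis_of B V" and C: "basis_of C W"
    using assms(1,2) basis_of_ex by metis
  show ?thesis
    using trace_swap_bases[OF B C f g] f g
    by (simp add: trace_basis[OF B] trace_basis[OF C] lin_compose)
qed

lemma trace_image:
  assumes "subspace V" "subspace W" "W \<subseteq> V" "lin f" "\<And>v. v \<in> V \<Longrightarrow> f v \<in> W"
  shows "trace V f = trace W f"
  using trace_swap[OF assms(1,2,4) _ lin_id] assms by auto

lemma trace_cong:
  assumes "subspace V" "\<And>v. v \<in> V \<Longrightarrow> f v = g v"
  shows "trace V f = trace V g"
proof -
  obtain B where "basis_of B V" using assms(1) basis_of_ex by metis
  then have "basis_of (SOME B. basis_of B V) V" by (rule someI)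
  then show ?thesis using assms(2) by (simp add: trace_def basis_of_subset)
qed

lemma trace_add:
  assumes V: "subspace V" and f: "lin f" "\<And>v. v \<in> V \<Longrightarrow> f v \<in> V" and g: "lin g" "\<And>v. v \<in> V \<Longrightarrow> g v \<in> V"
  shows "trace V (\<lambda>v. f v + g v) = trace V f + trace V g"
proof -
  obtain B where B: "basis_of B V" using V basis_of_ex by metis
  have "f b \<in> span B \<and> g b \<in> span B" if "b \<in> B" for b
    using f g B basis_of_subset[OF B that] by (auto simp: basis_of_def)
  then show ?thesis
    using B V f g
    by (simp add: trace_basis[OF B] lin_plus subspace_add basis_of_def representation_add
        sum.distrib)
qed

lemma trace_scaled:
  assumes V: "subspace V" and f: "lin f" "\<And>v. v \<in> V \<Longrightarrow> f v \<in> V"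
  shows "trace V (\<lambda>v. scale c (f v)) = c * trace V f"
proof -
  obtain B where B: "basis_of B V" using V basis_of_ex by metis
  have "f b \<in> span B" if "b \<in> B" for b
    using f B basis_of_subset[OF B that] by (auto simp: basis_of_def)
  then show ?thesis
    using B V f
    by (simp add: trace_basis[OF B] lin_scaled subspace_scale basis_of_def representation_scale
        sum_distrib_left)
qed

lemma trace_diff:
  assumes V: "subspace V" and f: "lin f" "\<And>v. v \<in> V \<Longrightarrow> f v \<in> V" and g: "lin g" "\<And>v. v \<in> V \<Longrightarrow> g v \<in> V"
  shows "trace V (\<lambda>v. f v - g v) = trace V f - trace V g"
  using trace_add[OF V f, of "\<lambda>v. scale (-1) (g v)"] trace_scaled[OF V g, of "-1"] V g
  by (simp add: lin_scaled[of g "-1", simplified] subspace_neg)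

lemma trace_sum:
  assumes V: "subspace V" and f: "\<And>i. i \<in> I \<Longrightarrow> lin (f i)" "\<And>i v. i \<in> I \<Longrightarrow> v \<in> V \<Longrightarrow> f i v \<in> V"
  shows "trace V (\<lambda>v. \<Sum>i\<in>I. f i v) = (\<Sum>i\<in>I. trace V (f i))"
  using f
proof (induction I rule: infinite_finite_induct)
  case (insert i I)
  then show ?case
    using trace_add[OF V, of "f i" "\<lambda>v. \<Sum>i\<in>I. f i v"] V by (simp add: lin_sum_maps subspace_sum)
qed (use trace_scaled[OF V lin_id, of 0] in auto)

lemma trace_scalar: "subspace V \<Longrightarrow> trace V (\<lambda>v. scale c v) = of_nat (dim V) * c"
proof -
  assume V: "subspace V"
  obtain B where B: "basis_of B V" using V basis_of_ex by metis
  have "trace V (\<lambda>v. v) = of_nat (dim V)"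
    using B by (simp add: trace_basis[OF B lin_id] basis_of_def representation_basis
        basis_of_card[OF B, symmetric])
  then show ?thesis using trace_scaled[OF V lin_id, of c] by simp
qed

lemma uniformly_nilpotent:
  assumes V: "subspace V" and f: "lin f" and nil: "\<And>v. v \<in> V \<Longrightarrow> \<exists>n. (f ^^ n) v = 0"
  obtains N where "\<And>v. v \<in> V \<Longrightarrow> (f ^^ N) v = 0"
proof -
  obtain B where B: "basis_of B V" using V basis_of_ex by metis
  obtain n where n: "\<And>b. b \<in> B \<Longrightarrow> (f ^^ n b) b = 0"
    using nil basis_of_subset[OF B] by metis
  \<comment> \<open>The sum of the exponents over the finite basis is a crude common bound.\<close>
  have "(f ^^ (\<Sum>b\<in>B. n b)) v = 0" if "v \<in> V" for v
  proof -
    have "v \<in> {v. (f ^^ (\<Sum>b\<in>B. n b)) v = 0}"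
    proof (rule span_induct_lin)
      show "v \<in> span B" using B that by (simp add: basis_of_def)
      show "subspace {v. (f ^^ (\<Sum>b\<in>B. n b)) v = 0}"
        by (intro lin_kernel_subspace lin_funpow f)
      show "x \<in> {v. (f ^^ (\<Sum>b\<in>B. n b)) v = 0}" if "x \<in> B" for x
        using funpow_zero_mono[OF f n[OF that]] member_le_sum[OF that, of n] basis_of_finite[OF B]
        by simp
    qed
    then show ?thesis by simp
  qed
  then show ?thesis using that by blast
qed

text \<open>Replacing the space by its image under \<open>f\<close> does not change the trace, and
  after \<open>N\<close> replacements only the zero space is left. No triangular form is
  involved.\<close>

lemma trace_nilpotent:
  assumes V: "subspace V" and f: "lin f" "\<And>v. v \<in> V \<Longrightarrow> f v \<in> V"
    and nil: "\<And>v. v \<in> V \<Longrightarrow> \<exists>n. (f ^^ n) v = 0"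
  shows "trace V f = 0"
proof -
  obtain N where N: "\<And>v. v \<in> V \<Longrightarrow> (f ^^ N) v = 0"
    using uniformly_nilpotent[OF V f(1) nil] by metis
  have "trace V f = trace ((f ^^ k) ` V) f" for k
  proof (induction k)
    case (Suc k)
    have "trace ((f ^^ k) ` V) f = trace ((f ^^ Suc k) ` V) f"
    proof (rule trace_image)
      show "(f ^^ Suc k) ` V \<subseteq> (f ^^ k) ` V"
        using f(2) by (auto simp: funpow_swap1)
      show "subspace ((f ^^ k) ` V)" "subspace ((f ^^ Suc k) ` V)"
        by (rule lin_image_subspace[OF lin_funpow[OF f(1)] V])+
    qed (use f(1) in auto)
    then show ?case using Suc by simp
  qed simp
  from this[of N] have "trace V f = trace {0} f"
    using N V subspace_0[OF V] by (metis (no_types, lifting) image_cong image_constant_conv empty_iff)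
  also have "\<dots> = trace {0} (\<lambda>v. scale 0 v)"
    by (rule trace_cong) (auto simp: lin_zero f)
  finally show ?thesis by (simp only: trace_scalar[OF subspace_single_0] mult_zero_right)
qed

lemma lin_shift: "lin f \<Longrightarrow> lin (\<lambda>v. f v - scale c v)"
  by (intro lin_minus lin_scaled lin_id)

text \<open>Subtracting the scalar \<open>c\<close> leaves a nilpotent map, which has trace
  zero.\<close>

lemma trace_single_eigenvalue:
  assumes V: "subspace V" and f: "lin f" "\<And>v. v \<in> V \<Longrightarrow> f v \<in> V"
    and nil: "\<And>v. v \<in> V \<Longrightarrow> \<exists>n. ((\<lambda>v. f v - scale c v) ^^ n) v = 0"
  shows "trace V f = of_nat (dim V) * c"
proof -
  have "trace V (\<lambda>v. f v - scale c v) = 0"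
    by (rule trace_nilpotent) (use V f nil in \<open>auto simp: lin_shift subspace_diff subspace_scale\<close>)
  then show ?thesis
    using trace_diff[OF V f lin_scaled[OF lin_id, of c]] V
    by (simp add: subspace_scale trace_scalar)
qed

lemma trace_projection:
  assumes V: "subspace V" and f: "lin f" and W: "subspace W" "W \<subseteq> V"
    and "\<And>v. v \<in> V \<Longrightarrow> f v \<in> W" "\<And>w. w \<in> W \<Longrightarrow> f w = w"
  shows "trace V f = of_nat (dim W)"
proof -
  have "trace V f = trace W f" by (rule trace_image) (use assms in auto)
  also have "\<dots> = trace W (\<lambda>v. scale 1 v)" by (rule trace_cong) (use assms in auto)
  finally show ?thesis by (simp only: trace_scalar[OF W(1)] mult_1_right)
qed

lemma basis_of_direct_sum:
  assumes A: "basis_of A V" and B: "basis_of B W" and dis: "V \<inter> W = {0}"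
  shows "basis_of (A \<union> B) (span (V \<union> W))" "A \<inter> B = {}"
proof -
  have fin: "finite A" "finite B" using A B by (simp_all add: basis_of_finite)
  have sp: "independent A" "span A = V" "independent B" "span B = W"
    using A B by (simp_all add: basis_of_def)
  have V: "subspace V" and W: "subspace W"
    using subspace_span[of A] subspace_span[of B] by (simp_all add: sp)
  show AB: "A \<inter> B = {}"
  proof (rule ccontr)
    assume "A \<inter> B \<noteq> {}"
    then obtain x where x: "x \<in> A" "x \<in> B" by blast
    then have "x \<in> V \<inter> W" using basis_of_subset[OF A] basis_of_subset[OF B] by simp
    then have "0 \<in> A" using x(1) dis by simp
    then show False using dependent_zero sp(1) by simp
  qed
  have "span (A \<union> B) = span (V \<union> W)"
    using span_eq_iff[THEN iffD2, OF V] span_eq_iff[THEN iffD2, OF W] by (simp only: span_Un sp)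
  moreover have "independent (A \<union> B)"
  proof (rule independent_if_scalars_zero)
    show "finite (A \<union> B)" using fin by simp
    fix u x assume u: "(\<Sum>x\<in>A \<union> B. scale (u x) x) = 0" and x: "x \<in> A \<union> B"
    define a where "a = (\<Sum>x\<in>A. scale (u x) x)"
    define b where "b = (\<Sum>x\<in>B. scale (u x) x)"
    have ab: "a + b = 0" using u AB fin by (simp add: a_def b_def sum.union_disjoint)
    have a: "a \<in> V" unfolding a_def
      by (intro subspace_sum[OF V] subspace_scale[OF V] basis_of_subset[OF A])
    have b: "b \<in> W" unfolding b_def
      by (intro subspace_sum[OF W] subspace_scale[OF W] basis_of_subset[OF B])
    have "a = - b" using ab by (simp add: eq_neg_iff_add_eq_0)
    then have "a \<in> V \<inter> W" using a subspace_neg[OF W b] by simp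
    then have "a = 0" using dis by blast
    moreover from this ab have "b = 0" by simp
    ultimately show "u x = 0"
      using x independentD[OF sp(1) fin(1) subset_refl, of u x]
        independentD[OF sp(3) fin(2) subset_refl, of u x]
      unfolding a_def b_def by blast
  qed
  ultimately show "basis_of (A \<union> B) (span (V \<union> W))" by (simp add: basis_of_def)
qed

lemma span_Un_inv:
  assumes "lin f" "\<And>v. v \<in> V \<Longrightarrow> f v \<in> V" "\<And>v. v \<in> W \<Longrightarrow> f v \<in> W" "v \<in> span (V \<union> W)"
  shows "f v \<in> span (V \<union> W)"
  using lin_span_into[OF assms(1) _ subspace_span assms(4)] assms(2,3)
  by (metis Un_iff span_base)

lemma trace_direct_sum:
  assumes V: "subspace V" and W: "subspace W" and dis: "V \<inter> W = {0}"
    and f: "lin f" "\<And>v. v \<in> V \<Longrightarrow> f v \<in> V" "\<And>v. v \<in> W \<Longrightarrow> f v \<in> W"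
  shows "trace (span (V \<union> W)) f = trace V f + trace W f"
proof -
  obtain A B where A: "basis_of A V" and B: "basis_of B W" using V W basis_of_ex by metis
  note AB = basis_of_direct_sum[OF A B dis]
  have ext: "representation (A \<union> B) (f b) b = representation C (f b) b"
    if "basis_of C U" "C \<subseteq> A \<union> B" "f b \<in> U" for b C U
    using that AB(1) by (subst representation_extend[of _ _ C]) (auto simp: basis_of_def)
  have "trace (span (V \<union> W)) f = (\<Sum>b\<in>A \<union> B. representation (A \<union> B) (f b) b)"
    by (rule trace_basis[OF AB(1) f(1)]) (use span_Un_inv f in metis)
  also have "\<dots> = (\<Sum>b\<in>A. representation (A \<union> B) (f b) b) + (\<Sum>b\<in>B. representation (A \<union> B) (f b) b)"
    using AB(2) A B by (simp add: sum.union_disjoint basis_of_finite)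
  also have "\<dots> = (\<Sum>b\<in>A. representation A (f b) b) + (\<Sum>b\<in>B. representation B (f b) b)"
    using ext[OF A] ext[OF B] f basis_of_subset[OF A] basis_of_subset[OF B] by simp
  finally show ?thesis by (simp add: trace_basis[OF A f(1,2)] trace_basis[OF B f(1,3)])
qed

section \<open>Generalized eigenspaces\<close>

definition gen_eig :: "('b \<Rightarrow> 'b) \<Rightarrow> 'a \<Rightarrow> 'b set" where
  "gen_eig f c = {v. \<exists>n. ((\<lambda>v. f v - scale c v) ^^ n) v = 0}"

lemma subspace_gen_eig: assumes f: "lin f" shows "subspace (gen_eig f c)"
proof (rule subspaceI)
  let ?g = "\<lambda>v. f v - scale c v"
  have g: "lin ?g" by (rule lin_shift[OF f])
  show "0 \<in> gen_eig f c" unfolding gen_eig_def by (auto intro: exI[of _ 0])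
  fix x y assume "x \<in> gen_eig f c" "y \<in> gen_eig f c"
  then obtain n k where "(?g ^^ n) x = 0" "(?g ^^ k) y = 0" by (auto simp: gen_eig_def)
  then have "(?g ^^ max n k) x = 0" "(?g ^^ max n k) y = 0"
    using funpow_zero_mono[OF g] by (metis max.cobounded1, metis max.cobounded2)
  then have "(?g ^^ max n k) (x + y) = 0" by (simp add: lin_add[OF lin_funpow[OF g]])
  then show "x + y \<in> gen_eig f c" by (auto simp: gen_eig_def)
next
  fix a x assume "x \<in> gen_eig f c"
  then show "scale a x \<in> gen_eig f c"
    by (auto simp: gen_eig_def lin_scale[OF lin_funpow[OF lin_shift[OF f]]])
qed

lemma gen_eig_step: "f v - scale c v \<in> gen_eig f c \<Longrightarrow> v \<in> gen_eig f c"
proof -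
  assume "f v - scale c v \<in> gen_eig f c"
  then obtain n where "((\<lambda>v. f v - scale c v) ^^ n) (f v - scale c v) = 0"
    by (auto simp: gen_eig_def)
  then have "((\<lambda>v. f v - scale c v) ^^ Suc n) v = 0" by (subst funpow_Suc_right) simp
  then show ?thesis unfolding gen_eig_def by blast
qed

text \<open>Induction on the exponent belonging to \<open>d\<close>: the vector
  \<open>f v - scale d v\<close> satisfies the same hypotheses with a smaller exponent, so it
  vanishes. Then \<open>f - c\<close> acts on \<open>v\<close> as the nonzero scalar
  \<open>d - c\<close>, and no power of it can kill a nonzero \<open>v\<close>.\<close>

lemma gen_eig_disjoint:
  assumes f: "lin f" and "v \<in> gen_eig f c" "v \<in> gen_eig f d" "c \<noteq> d"
  shows "v = 0"
proof -
  let ?g = "\<lambda>v. f v - scale c v"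
  have g: "lin ?g" by (rule lin_shift[OF f])
  obtain n where n: "(?g ^^ n) v = 0" using assms by (auto simp: gen_eig_def)
  obtain k where k: "((\<lambda>v. f v - scale d v) ^^ k) v = 0" using assms by (auto simp: gen_eig_def)
  have "((\<lambda>v. f v - scale d v) ^^ k) v = 0 \<Longrightarrow> (?g ^^ n) v = 0 \<Longrightarrow> v = 0" for v
  proof (induction k arbitrary: v)
    case (Suc k)
    let ?u = "f v - scale d v"
    have u: "?u = ?g v + scale (c - d) v" by (simp add: scale_left_diff_distrib)
    have "(?g ^^ n) (?g v) = 0"
      using Suc.prems(2) by (metis funpow_swap1 g lin_zero)
    then have "(?g ^^ n) ?u = 0"
      unfolding u using Suc.prems(2) by (simp add: lin_add[OF lin_funpow[OF g]] lin_scale[OF lin_funpow[OF g]])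
    moreover have "((\<lambda>v. f v - scale d v) ^^ k) ?u = 0"
      using Suc.prems(1) by (subst (asm) funpow_Suc_right) simp
    ultimately have "?u = 0" using Suc.IH by blast
    then have *: "?g v = scale (d - c) v" by (simp add: scale_left_diff_distrib)
    have "(?g ^^ j) v = scale ((d - c) ^ j) v" for j
    proof (induction j)
      case (Suc j)
      have "(?g ^^ Suc j) v = ?g ((?g ^^ j) v)" by simp
      also have "\<dots> = scale ((d - c) ^ j) (?g v)" unfolding Suc by (rule lin_scale[OF g])
      finally show ?case using * by (simp add: mult.commute)
    qed simp
    then show "v = 0" using Suc.prems(2) assms(4) by simp
  qed simp
  then show ?thesis using n k by blast
qed

lemma gen_eig_inv:
  assumes "lin f" "v \<in> gen_eig f c" shows "f v - scale c v \<in> gen_eig f c"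
proof -
  obtain n where "((\<lambda>v. f v - scale c v) ^^ n) v = 0" using assms by (auto simp: gen_eig_def)
  then have "((\<lambda>v. f v - scale c v) ^^ n) (f v - scale c v) = 0"
    using funpow_swap1[of "\<lambda>v. f v - scale c v" n v] lin_zero[OF lin_shift[OF assms(1), of c]] by simp
  then show ?thesis by (auto simp: gen_eig_def)
qed

text \<open>On this space \<open>f - d\<close> is the nonzero scalar \<open>c - d\<close> plus a
  nilpotent map, hence onto. The preimage is built by induction on the nilpotency exponent.\<close>

lemma gen_eig_surj:
  assumes f: "lin f" and V: "subspace V" "\<And>v. v \<in> V \<Longrightarrow> f v \<in> V" and "c \<noteq> d"
    and "u \<in> V \<inter> gen_eig f c"
  obtains u' where "u' \<in> V \<inter> gen_eig f c" "f u' - scale d u' = u"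
proof -
  obtain n where n: "((\<lambda>v. f v - scale c v) ^^ n) u = 0" using assms by (auto simp: gen_eig_def)
  have "((\<lambda>v. f v - scale c v) ^^ n) u = 0 \<Longrightarrow> u \<in> V \<inter> gen_eig f c \<Longrightarrow>
    \<exists>u'. u' \<in> V \<inter> gen_eig f c \<and> f u' - scale d u' = u" for u
  proof (induction n arbitrary: u)
    case 0
    then show ?case using subspace_0[OF V(1)] subspace_0[OF subspace_gen_eig[OF f]]
      by (intro exI[of _ 0]) (auto simp: lin_zero[OF f])
  next
    case (Suc n)
    let ?w = "f u - scale c u"
    have "((\<lambda>v. f v - scale c v) ^^ n) ?w = 0"
      using Suc.prems(1) by (subst (asm) funpow_Suc_right) simp
    moreover have "?w \<in> V \<inter> gen_eig f c"
      using Suc.prems(2) V gen_eig_inv[OF f] by (auto simp: subspace_diff subspace_scale)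
    ultimately obtain w' where w': "w' \<in> V \<inter> gen_eig f c" "f w' - scale d w' = ?w"
      using Suc.IH by blast
    \<comment> \<open>Since \<open>f - d\<close> sends \<open>w'\<close> to
      \<open>(f - c) u\<close>, it sends \<open>u - w'\<close> to
      \<open>(f - d) u - (f - c) u = (c - d) u\<close>.\<close>
    let ?u' = "scale (1 / (c - d)) (u - w')"
    have "f ?u' - scale d ?u' = scale (1 / (c - d)) ((f u - scale d u) - (f w' - scale d w'))"
      by (simp add: lin_scale[OF f] lin_diff[OF f] scale_right_diff_distrib mult.commute)
    also have "(f u - scale d u) - (f w' - scale d w') = scale (c - d) u"
      unfolding w'(2) by (simp add: scale_left_diff_distrib)
    finally have "f ?u' - scale d ?u' = u" using \<open>c \<noteq> d\<close> by simp
    moreover have "?u' \<in> V \<inter> gen_eig f c"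
      using w'(1) Suc.prems(2) V subspace_gen_eig[OF f]
      by (auto intro!: subspace_scale subspace_diff)
    ultimately show ?case by blast
  qed
  then show ?thesis using n assms(5) that by blast
qed

section \<open>Primary decomposition over an algebraically closed field\<close>

definition poly_map :: "('b \<Rightarrow> 'b) \<Rightarrow> 'a poly \<Rightarrow> 'b \<Rightarrow> 'b" where
  "poly_map f p v = (\<Sum>i\<le>degree p. scale (coeff p i) ((f ^^ i) v))"

lemma poly_map_eq:
  "degree p \<le> n \<Longrightarrow> poly_map f p v = (\<Sum>i\<le>n. scale (coeff p i) ((f ^^ i) v))"
  unfolding poly_map_def by (rule sum.mono_neutral_left) (auto simp: coeff_eq_0)

text \<open>This lets one root be peeled off an annihilating polynomial: the linear factor acts on
  the vector first, the quotient afterwards.\<close>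

lemma poly_map_linear_factor:
  assumes f: "lin f"
  shows "poly_map f ([:- c, 1:] * q) v = poly_map f q (f v - scale c v)"
proof -
  let ?n = "degree q"
  have eq: "[:- c, 1:] * q = pCons 0 q - smult c q" by simp
  have "degree ([:- c, 1:] * q) \<le> Suc ?n"
    unfolding eq by (intro degree_diff_le degree_pCons_le) (simp add: degree_smult_le le_SucI)
  then have "poly_map f ([:- c, 1:] * q) v
      = (\<Sum>i\<le>Suc ?n. scale (coeff (pCons 0 q) i - c * coeff q i) ((f ^^ i) v))"
    by (simp only: poly_map_eq eq) simp
  also have "\<dots> = (\<Sum>i\<le>Suc ?n. scale (coeff (pCons 0 q) i) ((f ^^ i) v))
      - (\<Sum>i\<le>Suc ?n. scale (c * coeff q i) ((f ^^ i) v))"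
    by (simp only: scale_left_diff_distrib sum_subtractf)
  also have "(\<Sum>i\<le>Suc ?n. scale (coeff (pCons 0 q) i) ((f ^^ i) v))
      = (\<Sum>i\<le>?n. scale (coeff q i) ((f ^^ i) (f v)))"
    by (subst sum.atMost_Suc_shift) (simp add: funpow_swap1)
  also have "(\<Sum>i\<le>Suc ?n. scale (c * coeff q i) ((f ^^ i) v))
      = (\<Sum>i\<le>?n. scale (coeff q i) ((f ^^ i) (scale c v)))"
    by (simp add: coeff_eq_0 lin_scale[OF lin_funpow[OF f]] mult.commute)
  finally show ?thesis
    by (simp add: poly_map_def lin_diff[OF lin_funpow[OF f]] scale_right_diff_distrib sum_subtractf)
qed

lemma span_image_lessThan:
  "y \<in> span (g ` {..<k}) \<Longrightarrow> \<exists>c. y = (\<Sum>i<(k::nat). scale (c i) (g i))"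
proof (induction k arbitrary: y)
  case (Suc k)
  then obtain a where "y - scale a (g k) \<in> span (g ` {..<k})"
    by (auto simp: lessThan_Suc span_breakdown_eq)
  then obtain c where "y - scale a (g k) = (\<Sum>i<k. scale (c i) (g i))" using Suc.IH by blast
  then have "y = (\<Sum>i<Suc k. scale ((c(k := a)) i) (g i))"
    by (simp add: algebra_simps)
  then show ?case by blast
qed simp

lemma annihilating_poly: obtains p where "p \<noteq> 0" "poly_map f p v = 0"
proof -
  let ?S = "\<lambda>k. (\<lambda>i. (f ^^ i) v) ` {..<k}"
  \<comment> \<open>Otherwise the iterates of index 0 to \<open>dimension\<close> would be
    independent, one too many.\<close>
  have "\<exists>k. (f ^^ k) v \<in> span (?S k)"
  proof (rule ccontr)
    assume no: "\<not> ?thesis"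
    have "dim (?S k) = k" for k
    proof (induction k)
      case (Suc k)
      then show ?case using no by (simp add: lessThan_Suc dim_insert)
    qed simp
    from this[of "Suc dimension"] show False
      using dim_subset_UNIV[of "?S (Suc dimension)"] by simp
  qed
  then obtain k c where k: "(f ^^ k) v = (\<Sum>i<k. scale (c i) ((f ^^ i) v))"
    using span_image_lessThan by blast
  \<comment> \<open>The coefficient -1 at \<open>k\<close> encodes the dependence and keeps the
    polynomial nonzero.\<close>
  define d where "d i = (if i = k then -1 else c i)" for i
  define p where "p = (\<Sum>i\<le>k. monom (d i) i)"
  have co: "coeff p i = (if i \<le> k then d i else 0)" for i
    by (simp add: p_def coeff_sum if_distrib[of "\<lambda>x. x = _"] sum.delta' flip: if_distribR)
  then have "degree p \<le> k" by (intro degree_le) auto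
  then have "poly_map f p v = (\<Sum>i\<le>k. scale (d i) ((f ^^ i) v))"
    by (simp add: poly_map_eq co)
  also have "\<dots> = (\<Sum>i<k. scale (d i) ((f ^^ i) v)) + scale (d k) ((f ^^ k) v)"
    by (simp add: lessThan_Suc_atMost[symmetric])
  also have "(\<Sum>i<k. scale (d i) ((f ^^ i) v)) = (f ^^ k) v"
    unfolding k by (rule sum.cong) (auto simp: d_def)
  finally have "poly_map f p v = 0" by (simp add: d_def)
  moreover have "coeff p k \<noteq> 0" by (simp add: co d_def)
  ultimately show ?thesis using that by (metis coeff_0)
qed

text \<open>One root at a time: if \<open>c\<close> is a root of a polynomial annihilating
  \<open>v\<close>, then \<open>(f - c) v\<close> is annihilated by one of smaller degree and lies
  in the sum by induction. This is lifted back along \<open>f - c\<close>, which is onto on every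
  generalized eigenspace except possibly that of \<open>c\<close>, where the defect is
  absorbed.\<close>

lemma primary_decomposition:
  assumes ac: "alg_closed_field TYPE('a)" and f: "lin f" and V: "subspace V" "\<And>v. v \<in> V \<Longrightarrow> f v \<in> V"
    and v: "v \<in> V"
  shows "v \<in> span (\<Union>c. V \<inter> gen_eig f c)"
proof -
  let ?E = "span (\<Union>c. V \<inter> gen_eig f c)"
  have corr: "\<exists>u'\<in>?E. u - (f u' - scale d u') \<in> V \<inter> gen_eig f d" if u: "u \<in> ?E" for u d
  proof -
    define g where "g = (\<lambda>v. f v - scale d v)"
    have g: "lin g" unfolding g_def by (rule lin_shift[OF f])
    have S: "subspace (V \<inter> gen_eig f d)" by (intro subspace_inter V subspace_gen_eig f)
    have "u \<in> {x + y |x y. x \<in> V \<inter> gen_eig f d \<and> y \<in> g ` ?E}"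
    proof (rule span_induct_lin[OF u])
      show "subspace {x + y |x y. x \<in> V \<inter> gen_eig f d \<and> y \<in> g ` ?E}"
        by (rule subspace_sums[OF S lin_image_subspace[OF g subspace_span]])
      fix x assume "x \<in> (\<Union>c. V \<inter> gen_eig f c)"
      then obtain c where c: "x \<in> V \<inter> gen_eig f c" by blast
      show "x \<in> {x + y |x y. x \<in> V \<inter> gen_eig f d \<and> y \<in> g ` ?E}"
      proof (cases "c = d")
        case True
        have "g 0 \<in> g ` ?E" by (intro imageI span_zero)
        then have "x = x + g 0" "g 0 \<in> g ` ?E" by (simp_all add: lin_zero[OF g])
        then show ?thesis using c True by blast
      next
        case False
        then obtain x' where x': "x' \<in> V \<inter> gen_eig f c" "g x' = x"
          unfolding g_def using gen_eig_surj[OF f V _ c] by blast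
        have "x' \<in> ?E" by (rule span_base) (use x'(1) in blast)
        then have "x = 0 + g x'" "g x' \<in> g ` ?E" by (simp_all add: x'(2)[symmetric])
        then show ?thesis using subspace_0[OF S] by blast
      qed
    qed
    then obtain x u' where x: "u = x + g u'" "x \<in> V \<inter> gen_eig f d" "u' \<in> ?E" by blast
    then have "u - g u' \<in> V \<inter> gen_eig f d" by simp
    then show ?thesis using x(3) unfolding g_def by blast
  qed
  obtain p where p: "p \<noteq> 0" "poly_map f p v = 0" by (rule annihilating_poly)
  have "poly_map f p v = 0 \<Longrightarrow> p \<noteq> 0 \<Longrightarrow> v \<in> V \<Longrightarrow> v \<in> ?E" for v
  proof (induction "degree p" arbitrary: p v)
    case 0
    obtain a where "p = [:a:]" by (rule degree_eq_zeroE[OF 0(1)[symmetric]])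
    then have "v = 0" using 0 by (simp add: poly_map_def)
    then show ?case by (simp add: span_zero)
  next
    case (Suc n)
    have "degree p > 0" using Suc.hyps(2) by simp
    then obtain c where "poly p c = 0" using ac unfolding alg_closed_field_def by blast
    then obtain q where q: "p = [:- c, 1:] * q" using poly_eq_0_iff_dvd by blast
    then have "q \<noteq> 0" using Suc.prems by auto
    then have "degree p = Suc (degree q)" unfolding q by (subst degree_mult_eq) auto
    then have "n = degree q" using Suc.hyps(2) by simp
    moreover have "poly_map f q (f v - scale c v) = 0"
      using Suc.prems(1) poly_map_linear_factor[OF f] by (simp only: q)
    moreover have "f v - scale c v \<in> V"
      using V Suc.prems(3) by (simp add: subspace_diff subspace_scale)
    ultimately have "f v - scale c v \<in> ?E" using Suc.hyps(1) \<open>q \<noteq> 0\<close> by blast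
    then obtain u' where u': "u' \<in> ?E" "f v - scale c v - (f u' - scale c u') \<in> V \<inter> gen_eig f c"
      using corr by blast
    \<comment> \<open>Correcting \<open>v\<close> by \<open>u'\<close> moves its image under
      \<open>f - c\<close> into the generalized eigenspace of \<open>c\<close>, which contains all
      preimages under \<open>f - c\<close> of its elements.\<close>
    have "f (v - u') - scale c (v - u') = f v - scale c v - (f u' - scale c u')"
      by (simp add: lin_diff[OF f] scale_right_diff_distrib)
    then have "v - u' \<in> gen_eig f c" using u'(2) gen_eig_step[of f "v - u'" c] by simp
    moreover have "u' \<in> V"
      by (rule span_induct_lin[OF u'(1) V(1)]) auto
    ultimately have "v - u' \<in> V \<inter> gen_eig f c" using Suc.prems(3) subspace_diff[OF V(1)] by blast
    then have "v - u' \<in> ?E" by (intro span_base) blast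
    from span_add[OF this u'(1)] show ?case by simp
  qed
  then show ?thesis using p v by blast
qed

end

section \<open>Generalized weight spaces of a nilpotent subalgebra\<close>

lemma last_nat_before: "P 0 \<Longrightarrow> \<not> P n \<Longrightarrow> \<exists>k::nat. P k \<and> \<not> P (Suc k)"
  by (induction n) auto

section \<open>Brackets, generalized eigenspaces and traces of commutators\<close>

locale fd_lie_algebra = finite_dimensional_vector_space smul Basis
  for smul :: "'k::field_char_0 \<Rightarrow> 'v::ab_group_add \<Rightarrow> 'v" and Basis :: "'v set" +
  fixes br :: "'v \<Rightarrow> 'v \<Rightarrow> 'v"
  assumes lie: "lie_algebra smul br"
    and alg_closed: "alg_closed_field TYPE('k)"
begin

lemma br_add_left: "br (x + y) z = br x z + br y z"
  and br_add_right: "br x (y + z) = br x y + br x z"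
  and br_scale_left: "br (smul a x) y = smul a (br x y)"
  and br_scale_right: "br x (smul a y) = smul a (br x y)"
  and br_self: "br x x = 0"
  and br_cyclic: "br x (br y z) + br y (br z x) + br z (br x y) = 0"
  using lie unfolding lie_algebra_def by blast+

lemma lin_br: "lin (br x)"
  by (rule linI) (simp_all add: br_add_right br_scale_right)

lemma lin_br_left: "lin (\<lambda>x. br x y)"
  by (rule linI) (simp_all add: br_add_left br_scale_left)

lemma br_0_left: "br 0 y = 0" and br_0_right: "br x 0 = 0"
  using lin_zero[OF lin_br_left] lin_zero[OF lin_br] by simp_all

lemma br_skew: "br y x = - br x y"
proof -
  have "br (x + y) (x + y) = br x y + br y x"
    unfolding br_add_left br_add_right by (simp add: br_self)
  from trans[OF sym[OF this] br_self] have "br x y + br y x = 0" .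
  then show ?thesis by (simp add: eq_neg_iff_add_eq_0 add.commute)
qed

lemma br_jacobi: "br x (br y z) = br (br x y) z + br y (br x z)"
proof -
  have "br x (br y z) = - br y (br z x) - br z (br x y)"
    using br_cyclic[of x y z] by (simp add: algebra_simps eq_neg_iff_add_eq_0)
  moreover have "br y (br z x) = - br y (br x z)"
    using br_skew[of z x] lin_diff[OF lin_br, of y 0 "br x z"] by (simp add: br_0_right)
  moreover have "br z (br x y) = - br (br x y) z" by (rule br_skew)
  ultimately show ?thesis by simp
qed

text \<open>By the Leibniz rule \<open>(ad h - a - b) [x, y]\<close> equals
  \<open>[(ad h - a) x, y] + [x, (ad h - b) y]\<close>. The induction is on the sum of the two
  nilpotency exponents.\<close>

lemma gen_eig_bracket:
  assumes "x \<in> gen_eig (br h) a" "y \<in> gen_eig (br h) b"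
  shows "br x y \<in> gen_eig (br h) (a + b)"
proof -
  define D where "D c v = br h v - smul c v" for c v
  have ge: "gen_eig (br h) c = {v. \<exists>n. (D c ^^ n) v = 0}" for c
    by (simp add: gen_eig_def D_def[abs_def])
  have S: "subspace (gen_eig (br h) (a + b))" by (rule subspace_gen_eig[OF lin_br])
  have *: "\<lbrakk>(D a ^^ p) x = 0; (D b ^^ q) y = 0\<rbrakk> \<Longrightarrow> br x y \<in> gen_eig (br h) (a + b)"
    if "p + q = n" for n p q x y
    using that
  proof (induction n arbitrary: p q x y rule: less_induct)
    case (less n)
    show ?case
    proof (cases "p = 0 \<or> q = 0")
      case True
      then have "x = 0 \<or> y = 0" using less.prems by auto
      then show ?thesis using subspace_0[OF S] by (auto simp: br_0_left br_0_right)
    next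
      case False
      then obtain p' q' where pq: "p = Suc p'" "q = Suc q'" using not0_implies_Suc by blast
      have "br (D a x) y \<in> gen_eig (br h) (a + b)"
      proof (rule less.IH)
        show "p' + q < n" using less.prems(3) pq by simp
        show "(D a ^^ p') (D a x) = 0"
          using less.prems(1) by (simp add: pq funpow_swap1)
        show "(D b ^^ q) y = 0" by (rule less.prems(2))
      qed simp
      moreover have "br x (D b y) \<in> gen_eig (br h) (a + b)"
      proof (rule less.IH)
        show "p + q' < n" using less.prems(3) pq by simp
        show "(D b ^^ q') (D b y) = 0"
          using less.prems(2) by (simp add: pq funpow_swap1)
        show "(D a ^^ p) x = 0" by (rule less.prems(1))
      qed simp
      moreover have "br h (br x y) - smul (a + b) (br x y) = br (D a x) y + br x (D b y)"
        unfolding D_def lin_diff[OF lin_br] lin_diff[OF lin_br_left] br_scale_left br_scale_right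
        by (simp add: br_jacobi[of h x y] scale_left_distrib)
      ultimately have "br h (br x y) - smul (a + b) (br x y) \<in> gen_eig (br h) (a + b)"
        using subspace_add[OF S] by simp
      then show ?thesis by (rule gen_eig_step)
    qed
  qed
  obtain p q where "(D a ^^ p) x = 0" "(D b ^^ q) y = 0" using assms unfolding ge by blast
  then show ?thesis using * by blast
qed

lemma trace_commutator:
  assumes V: "subspace V" and f: "lin f" "\<And>v. v \<in> V \<Longrightarrow> f v \<in> V" and g: "lin g" "\<And>v. v \<in> V \<Longrightarrow> g v \<in> V"
  shows "trace V (\<lambda>v. f (g v) - g (f v)) = 0"
proof -
  have "trace V (\<lambda>v. f (g v) - g (f v)) = trace V (\<lambda>v. f (g v)) - trace V (\<lambda>v. g (f v))"
    by (rule trace_diff[OF V lin_compose[OF f(1) g(1)] _ lin_compose[OF g(1) f(1)]])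
      (use f(2) g(2) in blast)+
  also have "trace V (\<lambda>v. f (g v)) = trace V (\<lambda>v. g (f v))"
    by (rule trace_swap[OF V V g f])
  finally show ?thesis by simp
qed

text \<open>\<open>ad [x, y]\<close> is the commutator of \<open>ad x\<close> and
  \<open>ad y\<close>, and both preserve \<open>V\<close>. The numerical relations along root
  strings come from suitable choices of \<open>V\<close>.\<close>

lemma trace_bracket:
  assumes V: "subspace V" and x: "\<And>v. v \<in> V \<Longrightarrow> br x v \<in> V" and y: "\<And>v. v \<in> V \<Longrightarrow> br y v \<in> V"
  shows "trace V (br (br x y)) = 0"
proof -
  have "br (br x y) = (\<lambda>v. br x (br y v) - br y (br x v))"
    by (rule ext) (simp add: br_jacobi[of x y])
  then show ?thesis using trace_commutator[OF V lin_br x lin_br y] by simp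
qed

end

locale nilpotent_action = fd_lie_algebra smul Basis br
  for smul :: "'k::field_char_0 \<Rightarrow> 'v::ab_group_add \<Rightarrow> 'v" and Basis br +
  fixes H :: "'v set"
  assumes nilpotent_H: "nilpotent_subalgebra smul br H"
begin

lemma subspace_H: "subspace H" and br_H: "x \<in> H \<Longrightarrow> y \<in> H \<Longrightarrow> br x y \<in> H"
  and lcs_H: "\<exists>n. lcs smul br H n = {0}"
  using nilpotent_H unfolding nilpotent_subalgebra_def lie_subalgebra_def by blast+

lemma lcs_subset: "lcs smul br H n \<subseteq> H"
proof (induction n)
  case (Suc n)
  then show ?case using br_H unfolding lcs.simps by (intro span_minimal subspace_H) blast
qed simp

lemma br_lcs: "h \<in> H \<Longrightarrow> y \<in> lcs smul br H n \<Longrightarrow> br h y \<in> lcs smul br H (Suc n)"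
  by (auto intro: span_base)

text \<open>Each application of \<open>ad h\<close> moves one step down the lower central
  series.\<close>

lemma H_gen_eig: assumes "h \<in> H" "x \<in> H" shows "x \<in> gen_eig (br h) 0"
proof -
  have "(br h ^^ n) x \<in> lcs smul br H n" for n
    by (induction n) (use assms br_lcs in \<open>simp_all del: lcs.simps(2)\<close>)
  moreover obtain n where "lcs smul br H n = {0}" using lcs_H by blast
  ultimately have "(br h ^^ n) x = 0" by blast
  then show ?thesis by (auto simp: gen_eig_def)
qed

text \<open>Engel's theorem for a nilpotent algebra: grow an ideal \<open>A\<close> of \<open>H\<close> that kills some vector modulo
\<open>U\<close>, one central dimension at a time.\<close>

lemma engel:
  assumes \<rho>_add: "\<And>x y v. x \<in> H \<Longrightarrow> y \<in> H \<Longrightarrow> \<rho> (x + y) v = \<rho> x v + \<rho> y v"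
    and \<rho>_scale: "\<And>a x v. x \<in> H \<Longrightarrow> \<rho> (smul a x) v = smul a (\<rho> x v)"
    and \<rho>_lin: "\<And>x. x \<in> H \<Longrightarrow> lin (\<rho> x)"
    and \<rho>_br: "\<And>x y v. x \<in> H \<Longrightarrow> y \<in> H \<Longrightarrow> \<rho> (br x y) v = \<rho> x (\<rho> y v) - \<rho> y (\<rho> x v)"
    and U: "subspace U" "\<And>x v. x \<in> H \<Longrightarrow> v \<in> U \<Longrightarrow> \<rho> x v \<in> U"
    and N: "\<And>x v. x \<in> H \<Longrightarrow> v \<in> N \<Longrightarrow> \<rho> x v \<in> N" "\<exists>v. v \<in> N - U"
    and nil: "\<And>x v. x \<in> H \<Longrightarrow> v \<in> N \<Longrightarrow> \<exists>n. (\<rho> x ^^ n) v = 0"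
  shows "\<exists>v\<in>N - U. \<forall>x\<in>H. \<rho> x v \<in> U"
proof -
  \<comment> \<open>The action \<open>\<rho>\<close> and the subspace \<open>U\<close> are kept
    general because the result serves twice: for \<open>ad\<close> modulo \<open>H\<close>, and for
    \<open>ad h - \<alpha> h\<close> modulo zero.\<close>
  define good where "good A \<longleftrightarrow> subspace A \<and> A \<subseteq> H \<and> (\<forall>x\<in>H. \<forall>a\<in>A. br x a \<in> A)
    \<and> (\<exists>v\<in>N - U. \<forall>a\<in>A. \<rho> a v \<in> U)" for A
  have \<rho>_0: "\<rho> 0 v = 0" for v
    using \<rho>_scale[OF subspace_0[OF subspace_H], of 0 v] by simp
  have "good {0}" unfolding good_def
    using N(2) subspace_0[OF subspace_H] subspace_0[OF U(1)] by (auto simp: \<rho>_0 br_0_right)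
  moreover have "\<forall>A. good A \<longrightarrow> dim A < Suc dimension"
    using dim_subset_UNIV by (simp add: less_Suc_eq_le)
  ultimately obtain A where A: "good A" and Amax: "\<And>A'. good A' \<Longrightarrow> dim A' \<le> dim A"
    using ex_has_greatest_nat[of good "{0}" dim "Suc dimension"] by blast
  from A have sA: "subspace A" and AH: "A \<subseteq> H" and iA: "\<And>x a. x \<in> H \<Longrightarrow> a \<in> A \<Longrightarrow> br x a \<in> A"
    and exA: "\<exists>v\<in>N - U. \<forall>a\<in>A. \<rho> a v \<in> U"
    unfolding good_def by blast+
  have "A = H"
  proof (rule ccontr)
    assume "A \<noteq> H"
    then have nA: "\<not> lcs smul br H 0 \<subseteq> A" using AH by simp
    obtain n where "lcs smul br H n = {0}" using lcs_H by blast
    then have "lcs smul br H n \<subseteq> A" using subspace_0[OF sA] by simp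
    \<comment> \<open>An element \<open>b\<close> of the last term of the lower central series that
      is not inside \<open>A\<close> is central modulo \<open>A\<close>: brackets with
      \<open>H\<close> move it into \<open>A\<close>.\<close>
    then obtain k where k: "\<not> lcs smul br H k \<subseteq> A" "lcs smul br H (Suc k) \<subseteq> A"
      using last_nat_before[of "\<lambda>k. \<not> lcs smul br H k \<subseteq> A"] nA by blast
    then obtain b where b: "b \<in> lcs smul br H k" "b \<notin> A" by blast
    then have bH: "b \<in> H" using lcs_subset by blast
    have brb: "br x b \<in> A" if "x \<in> H" for x
      using br_lcs[OF that b(1)] k(2) by blast
    let ?A' = "span (insert b A)"
    obtain v where v: "v \<in> N - U" "\<forall>a\<in>A. \<rho> a v \<in> U" using exA by blast
    have step: "(\<rho> b ^^ j) v \<in> N \<and> (\<forall>a\<in>A. \<rho> a ((\<rho> b ^^ j) v) \<in> U)" for j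
    proof (induction j)
      case 0
      then show ?case using v by simp
    next
      case (Suc j)
      let ?u = "(\<rho> b ^^ j) v"
      have "\<rho> a (\<rho> b ?u) \<in> U" if a: "a \<in> A" for a
      proof -
        have aH: "a \<in> H" using a AH by blast
        have "\<rho> a (\<rho> b ?u) = \<rho> (br a b) ?u + \<rho> b (\<rho> a ?u)"
          using \<rho>_br[OF aH bH, of ?u] by simp
        moreover have "\<rho> (br a b) ?u \<in> U" using Suc brb[OF aH] by blast
        moreover have "\<rho> b (\<rho> a ?u) \<in> U" using Suc a U(2)[OF bH] by blast
        ultimately show ?thesis using subspace_add[OF U(1)] by simp
      qed
      then show ?case using Suc N(1)[OF bH] by simp
    qed
    obtain n where n: "(\<rho> b ^^ n) v = 0" using nil[OF bH] v by blast
    then have nU: "(\<rho> b ^^ n) v \<in> U" using subspace_0[OF U(1)] by simp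
    have "(\<rho> b ^^ 0) v \<notin> U" using v by simp
    \<comment> \<open>The last iterate outside \<open>U\<close> is sent into \<open>U\<close> by
      \<open>b\<close>, and by \<open>step\<close> it is still killed by \<open>A\<close> modulo
      \<open>U\<close>; so \<open>b\<close> can be adjoined to \<open>A\<close>.\<close>
    then obtain j where j: "(\<rho> b ^^ j) v \<notin> U" "(\<rho> b ^^ Suc j) v \<in> U"
      using last_nat_before[of "\<lambda>j. (\<rho> b ^^ j) v \<notin> U"] nU by blast
    let ?u = "(\<rho> b ^^ j) v"
    have "good ?A'" unfolding good_def
    proof (intro conjI ballI)
      show "subspace ?A'" by (rule subspace_span)
      show A'H: "?A' \<subseteq> H" using span_minimal[OF _ subspace_H] AH bH by blast
      show "br x a \<in> ?A'" if x: "x \<in> H" and a: "a \<in> ?A'" for x a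
      proof (rule lin_span_into[OF lin_br _ subspace_span a])
        fix y assume "y \<in> insert b A"
        then have "br x y \<in> A" using brb[OF x] iA[OF x] by blast
        then show "br x y \<in> ?A'" by (intro span_base) blast
      qed
      show "\<exists>v\<in>N - U. \<forall>a\<in>?A'. \<rho> a v \<in> U"
      proof (intro bexI ballI)
        show "?u \<in> N - U" using step j by blast
        fix a assume a: "a \<in> ?A'"
        have "a \<in> {a \<in> H. \<rho> a ?u \<in> U}"
        proof (rule span_induct_lin[OF a])
          show "subspace {a \<in> H. \<rho> a ?u \<in> U}"
            using subspace_H U(1) by (intro subspaceI)
              (simp_all add: \<rho>_0 \<rho>_add \<rho>_scale subspace_0 subspace_add subspace_scale)
          show "x \<in> {a \<in> H. \<rho> a ?u \<in> U}" if "x \<in> insert b A" for x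
            using that step[of j] j(2) AH bH by auto
        qed
        then show "\<rho> a ?u \<in> U" by blast
      qed
    qed
    then have "dim ?A' \<le> dim A" by (rule Amax)
    moreover have "dim (insert b A) = Suc (dim A)"
      using b(2) unfolding dim_insert span_eq_iff[THEN iffD2, OF sA] by simp
    ultimately show False by simp
  qed
  then show ?thesis using exA by simp
qed

section \<open>Weight spaces, their independence, and weights as traces\<close>

definition wsp :: "('v \<Rightarrow> 'k) \<Rightarrow> 'v set" where
  "wsp \<alpha> = {v. \<forall>h\<in>H. v \<in> gen_eig (br h) (\<alpha> h)}"

text \<open>Only the values on \<open>H\<close> matter for a weight space; fixing the value 0
  elsewhere makes each weight a single function, as in \<open>roots\<close>, so that weights can be
  counted.\<close>

definition supp_H :: "('v \<Rightarrow> 'k) \<Rightarrow> bool" where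
  "supp_H \<alpha> \<longleftrightarrow> (\<forall>x. x \<notin> H \<longrightarrow> \<alpha> x = 0)"

definition weights :: "('v \<Rightarrow> 'k) set" where
  "weights = {\<alpha>. supp_H \<alpha> \<and> wsp \<alpha> \<noteq> {0}}"

lemma subspace_wsp: "subspace (wsp \<alpha>)"
proof -
  have "wsp \<alpha> = (\<Inter>h\<in>H. gen_eig (br h) (\<alpha> h))" by (auto simp: wsp_def)
  then show ?thesis by (simp add: subspace_Int subspace_gen_eig[OF lin_br])
qed

lemma wsp_bracket: "x \<in> wsp \<alpha> \<Longrightarrow> y \<in> wsp \<beta> \<Longrightarrow> br x y \<in> wsp (\<lambda>h. \<alpha> h + \<beta> h)"
  unfolding wsp_def using gen_eig_bracket by blast

lemma H_subset_wsp_0: "H \<subseteq> wsp (\<lambda>_. 0)"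
  unfolding wsp_def using H_gen_eig by blast

lemma wsp_inv: "h \<in> H \<Longrightarrow> v \<in> wsp \<alpha> \<Longrightarrow> br h v \<in> wsp \<alpha>"
  using wsp_bracket[of h "\<lambda>_. 0" v \<alpha>] H_subset_wsp_0 by auto

lemma wsp_cong: "(\<And>h. h \<in> H \<Longrightarrow> \<alpha> h = \<beta> h) \<Longrightarrow> wsp \<alpha> = wsp \<beta>"
  unfolding wsp_def by simp

lemma wsp_weight_ex:
  assumes "v \<in> wsp \<alpha>" "v \<noteq> 0"
  obtains \<beta> where "\<beta> \<in> weights" "\<And>h. h \<in> H \<Longrightarrow> \<beta> h = \<alpha> h" "wsp \<beta> = wsp \<alpha>"
proof -
  define \<beta> where "\<beta> h = (if h \<in> H then \<alpha> h else 0)" for h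
  have eq: "wsp \<beta> = wsp \<alpha>" by (rule wsp_cong) (simp add: \<beta>_def)
  then have "\<beta> \<in> weights" using assms unfolding weights_def supp_H_def by (auto simp: \<beta>_def)
  then show ?thesis using that[of \<beta>] eq by (simp add: \<beta>_def)
qed

text \<open>If some \<open>h\<close> has no single generalized eigenvalue on \<open>V\<close>, the
  generalized eigenspaces of \<open>ad h\<close> cut \<open>V\<close> into smaller pieces. These are
  again stable under \<open>H\<close>, because \<open>H\<close> lies in the generalized eigenspace
  of \<open>ad h\<close> for 0 and brackets add eigenvalues.\<close>

lemma weight_decomposition_gen:
  assumes V: "subspace V" "\<And>h v. h \<in> H \<Longrightarrow> v \<in> V \<Longrightarrow> br h v \<in> V"
  shows "V \<subseteq> span (\<Union>\<alpha>. V \<inter> wsp \<alpha>)"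
  using V
proof (induction "dim V" arbitrary: V rule: less_induct)
  case less
  note V = less.prems
  show ?case
  proof (cases "\<forall>h\<in>H. \<exists>c. V \<subseteq> gen_eig (br h) c")
    case True
    then obtain \<alpha> where "\<And>h. h \<in> H \<Longrightarrow> V \<subseteq> gen_eig (br h) (\<alpha> h)" by metis
    then have "V \<subseteq> V \<inter> wsp \<alpha>" unfolding wsp_def by blast
    also have "\<dots> \<subseteq> span (\<Union>\<alpha>. V \<inter> wsp \<alpha>)" by (intro subsetI span_base) blast
    finally show ?thesis .
  next
    case False
    then obtain h where h: "h \<in> H" "\<And>c. \<not> V \<subseteq> gen_eig (br h) c" by blast
    have sub: "V \<inter> gen_eig (br h) c \<subseteq> span (\<Union>\<alpha>. V \<inter> wsp \<alpha>)" for c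
    proof -
      let ?W = "V \<inter> gen_eig (br h) c"
      have W: "subspace ?W" by (intro subspace_inter V(1) subspace_gen_eig lin_br)
      have "br k v \<in> ?W" if "k \<in> H" "v \<in> ?W" for k v
        using V(2) that gen_eig_bracket[OF H_gen_eig[OF h(1) that(1)], of v c] by simp
      moreover have "dim ?W < dim V"
        using h(2)[of c] by (intro subspace_dim_less W V(1)) blast
      ultimately have "?W \<subseteq> span (\<Union>\<alpha>. ?W \<inter> wsp \<alpha>)" using less.hyps[of ?W] W by blast
      also have "\<dots> \<subseteq> span (\<Union>\<alpha>. V \<inter> wsp \<alpha>)" by (rule span_mono) blast
      finally show ?thesis .
    qed
    have "V \<subseteq> span (\<Union>c. V \<inter> gen_eig (br h) c)"
      using primary_decomposition[OF alg_closed lin_br V(1)] V(2)[OF h(1)] by blast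
    also have "\<dots> \<subseteq> span (\<Union>\<alpha>. V \<inter> wsp \<alpha>)"
      by (rule span_minimal) (use sub in \<open>auto simp del: span_eq_iff\<close>)
    finally show ?thesis .
  qed
qed

lemma weight_decomposition: "v \<in> span (\<Union>\<alpha>\<in>weights. wsp \<alpha>)"
proof -
  have "v \<in> span (\<Union>\<alpha>. UNIV \<inter> wsp \<alpha>)" using weight_decomposition_gen[of UNIV] by auto
  then show ?thesis
  proof (rule span_induct_lin[OF _ subspace_span])
    fix x assume "x \<in> (\<Union>\<alpha>. UNIV \<inter> wsp \<alpha>)"
    then obtain \<alpha> where x: "x \<in> wsp \<alpha>" by blast
    show "x \<in> span (\<Union>\<alpha>\<in>weights. wsp \<alpha>)"
    proof (cases "x = 0")
      case True
      then show ?thesis using span_zero by simp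
    next
      case False
      then obtain \<beta> where "\<beta> \<in> weights" "wsp \<beta> = wsp \<alpha>" using wsp_weight_ex[OF x] by metis
      then show ?thesis using x by (intro span_base) blast
    qed
  qed
qed

lemma span_Un_cases:
  assumes "v \<in> span (A \<union> B)" obtains x y where "v = x + y" "x \<in> span A" "y \<in> span B"
  using assms unfolding span_Un by blast

text \<open>Choose \<open>h\<close> separating \<open>\<beta>\<close> from one
  \<open>\<gamma>\<close> of the set. A power of \<open>D = ad h - \<gamma> h\<close> removes the
  component of weight \<open>\<gamma>\<close>, so by induction this power kills \<open>v\<close>,
  which then has two distinct generalized eigenvalues under \<open>ad h\<close>.\<close>

lemma wsp_disjoint:
  assumes "finite S" "\<And>\<gamma>. \<gamma> \<in> S \<Longrightarrow> supp_H \<gamma>" "supp_H \<beta>" "\<beta> \<notin> S"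
    and "v \<in> wsp \<beta>" "v \<in> span (\<Union>\<gamma>\<in>S. wsp \<gamma>)"
  shows "v = 0"
  using assms
proof (induction S arbitrary: v rule: finite_induct)
  case (insert \<gamma> S)
  let ?W = "span (\<Union>\<gamma>\<in>S. wsp \<gamma>)"
  have "\<beta> \<noteq> \<gamma>" using insert.prems by blast
  then obtain h where h: "h \<in> H" "\<beta> h \<noteq> \<gamma> h"
    using insert.prems(1)[of \<gamma>] insert.prems(2) unfolding supp_H_def by (metis ext insertI1)
  define D where "D = (\<lambda>v. br h v - smul (\<gamma> h) v)"
  have D: "lin D" unfolding D_def by (rule lin_shift[OF lin_br])
  have Dinv: "D v \<in> wsp \<alpha>" if "v \<in> wsp \<alpha>" for v \<alpha>
    unfolding D_def by (intro subspace_diff subspace_scale subspace_wsp wsp_inv h that)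
  have DW: "D v \<in> ?W" if "v \<in> ?W" for v
  proof (rule lin_span_into[OF D _ subspace_span that])
    fix x assume "x \<in> (\<Union>\<gamma>\<in>S. wsp \<gamma>)"
    then show "D x \<in> ?W" using Dinv by (intro span_base) blast
  qed
  have "v \<in> span (wsp \<gamma> \<union> (\<Union>\<gamma>\<in>S. wsp \<gamma>))" using insert.prems(5) by simp
  then obtain u w where uw: "v = u + w" "u \<in> span (wsp \<gamma>)" "w \<in> ?W" by (rule span_Un_cases)
  then have "u \<in> wsp \<gamma>" using span_eq_iff[THEN iffD2, OF subspace_wsp] by simp
  then have "u \<in> gen_eig (br h) (\<gamma> h)" using h(1) unfolding wsp_def by blast
  then obtain n where n: "(D ^^ n) u = 0" unfolding gen_eig_def D_def by blast
  have "(D ^^ n) v = (D ^^ n) w" using n by (simp add: uw(1) lin_add[OF lin_funpow[OF D]])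
  moreover have "(D ^^ n) w \<in> ?W" by (rule funpow_inv[OF DW uw(3)])
  moreover have "(D ^^ n) v \<in> wsp \<beta>" by (rule funpow_inv[OF Dinv insert.prems(4)])
  ultimately have "(D ^^ n) v = 0" using insert.IH insert.prems by simp
  then have "v \<in> gen_eig (br h) (\<gamma> h)" unfolding gen_eig_def D_def by blast
  moreover have "v \<in> gen_eig (br h) (\<beta> h)" using insert.prems(4) h(1) unfolding wsp_def by blast
  ultimately show ?case using gen_eig_disjoint[OF lin_br] h(2) by metis
qed simp

lemma weights_supp: "\<alpha> \<in> weights \<Longrightarrow> supp_H \<alpha>"
  by (simp add: weights_def)

lemma finite_weights: "finite weights"
proof (rule ccontr)
  assume "infinite weights"
  then obtain S where S: "finite S" "card S = Suc dimension" "S \<subseteq> weights"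
    using infinite_arbitrarily_large by metis
  have "card S \<le> dim (\<Union>\<gamma>\<in>S. wsp \<gamma>)" using S(1,3)
  proof (induction S rule: finite_induct)
    case (insert \<gamma> S)
    have "wsp \<gamma> \<noteq> {0}" using insert.prems unfolding weights_def by blast
    then obtain v where v: "v \<in> wsp \<gamma>" "v \<noteq> 0" using subspace_0[OF subspace_wsp] by blast
    have "v \<notin> span (\<Union>\<gamma>\<in>S. wsp \<gamma>)"
      using wsp_disjoint[of S \<gamma> v] insert weights_supp v by blast
    then have "Suc (dim (\<Union>\<gamma>\<in>S. wsp \<gamma>)) = dim (insert v (\<Union>\<gamma>\<in>S. wsp \<gamma>))"
      by (simp add: dim_insert)
    also have "\<dots> \<le> dim (\<Union>\<gamma>\<in>insert \<gamma> S. wsp \<gamma>)" by (rule dim_subset) (use v in auto)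
    finally show ?case using insert by simp
  qed simp
  then show False using dim_subset_UNIV[of "\<Union>\<gamma>\<in>S. wsp \<gamma>"] S(2) by simp
qed

text \<open>Subspaces \<open>U \<gamma>\<close> of the weight spaces are allowed because the
  one-dimensionality argument cuts one weight space down to a line.\<close>

lemma trace_weight_sum:
  assumes "finite S" "\<And>\<gamma>. \<gamma> \<in> S \<Longrightarrow> supp_H \<gamma>" "\<And>\<gamma>. \<gamma> \<in> S \<Longrightarrow> subspace (U \<gamma>)"
    and "\<And>\<gamma>. \<gamma> \<in> S \<Longrightarrow> U \<gamma> \<subseteq> wsp \<gamma>" "lin f" "\<And>\<gamma> v. \<gamma> \<in> S \<Longrightarrow> v \<in> U \<gamma> \<Longrightarrow> f v \<in> U \<gamma>"
  shows "trace (span (\<Union>\<gamma>\<in>S. U \<gamma>)) f = (\<Sum>\<gamma>\<in>S. trace (U \<gamma>) f)"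
  using assms
proof (induction S rule: finite_induct)
  case empty
  have "trace {0} f = trace {0} (\<lambda>v. smul 0 v)"
    by (rule trace_cong) (simp_all add: lin_zero[OF assms(5)])
  also have "\<dots> = 0" by (simp only: trace_scalar[OF subspace_single_0] mult_zero_right)
  finally show ?case by simp
next
  case (insert \<gamma> S)
  let ?W = "span (\<Union>\<gamma>\<in>S. U \<gamma>)"
  have U: "subspace (U \<gamma>)" using insert.prems by blast
  have dis: "U \<gamma> \<inter> ?W = {0}"
  proof -
    have "?W \<subseteq> span (\<Union>\<gamma>\<in>S. wsp \<gamma>)" by (rule span_mono) (use insert.prems(3) in blast)
    then have "v = 0" if "v \<in> U \<gamma> \<inter> ?W" for v
      using wsp_disjoint[of S \<gamma> v] insert.hyps insert.prems(1,3) that by blast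
    then show ?thesis using subspace_0[OF U] span_zero by blast
  qed
  have W: "f v \<in> ?W" if "v \<in> ?W" for v
  proof (rule lin_span_into[OF insert.prems(4) _ subspace_span that])
    fix x assume "x \<in> (\<Union>\<gamma>\<in>S. U \<gamma>)"
    then show "f x \<in> ?W" using insert.prems(5) by (intro span_base) blast
  qed
  have "span (\<Union>\<gamma>\<in>insert \<gamma> S. U \<gamma>) = span (U \<gamma> \<union> ?W)"
    by (simp only: UN_insert span_Un span_span)
  then have "trace (span (\<Union>\<gamma>\<in>insert \<gamma> S. U \<gamma>)) f = trace (span (U \<gamma> \<union> ?W)) f" by simp
  also have "\<dots> = trace (U \<gamma>) f + trace ?W f"
    by (rule trace_direct_sum[OF U subspace_span dis insert.prems(4) _ W]) (use insert.prems(5) in blast)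
  also have "trace ?W f = (\<Sum>\<gamma>\<in>S. trace (U \<gamma>) f)"
    by (rule insert.IH) (use insert.prems in \<open>simp_all add: subset_iff\<close>)
  finally show ?case using insert.hyps by simp
qed

lemma trace_wsp:
  assumes "subspace U" "U \<subseteq> wsp \<alpha>" "h \<in> H" "\<And>v. v \<in> U \<Longrightarrow> br h v \<in> U"
  shows "trace U (br h) = of_nat (dim U) * \<alpha> h"
proof (rule trace_single_eigenvalue[OF assms(1) lin_br assms(4)])
  show "\<exists>n. ((\<lambda>v. br h v - smul (\<alpha> h) v) ^^ n) v = 0" if "v \<in> U" for v
    using assms(2,3) that unfolding wsp_def gen_eig_def by blast
qed

lemma dim_weight_pos: "\<alpha> \<in> weights \<Longrightarrow> dim (wsp \<alpha>) > 0"
  using subspace_0[OF subspace_wsp, of \<alpha>] unfolding weights_def neq0_conv[symmetric] dim_eq_0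
  by blast

text \<open>The value of a weight at h is the trace of \<open>ad h\<close> on the weight space
  divided by its dimension, and traces are additive. The same reading gives
  \<open>weight_scale\<close> and, since commutators have trace zero,
  \<open>weight_bracket\<close>.\<close>

lemma weight_add:
  assumes a: "\<alpha> \<in> weights" and x: "x \<in> H" and y: "y \<in> H"
  shows "\<alpha> (x + y) = \<alpha> x + \<alpha> y"
proof -
  have "br (x + y) = (\<lambda>v. br x v + br y v)" by (rule ext) (rule br_add_left)
  then have "trace (wsp \<alpha>) (br (x + y)) = trace (wsp \<alpha>) (br x) + trace (wsp \<alpha>) (br y)"
    using trace_add[OF subspace_wsp lin_br wsp_inv[OF x] lin_br wsp_inv[OF y]] by simp
  then have "of_nat (dim (wsp \<alpha>)) * \<alpha> (x + y) = of_nat (dim (wsp \<alpha>)) * (\<alpha> x + \<alpha> y)"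
    using trace_wsp[OF subspace_wsp subset_refl] wsp_inv x y subspace_add[OF subspace_H x y]
    by (simp add: distrib_left)
  then show ?thesis using dim_weight_pos[OF a] by (simp del: dim_eq_0)
qed

lemma weight_scale:
  assumes a: "\<alpha> \<in> weights" and x: "x \<in> H"
  shows "\<alpha> (smul c x) = c * \<alpha> x"
proof -
  have "br (smul c x) = (\<lambda>v. smul c (br x v))" by (rule ext) (rule br_scale_left)
  then have "trace (wsp \<alpha>) (br (smul c x)) = c * trace (wsp \<alpha>) (br x)"
    using trace_scaled[OF subspace_wsp lin_br wsp_inv[OF x]] by simp
  then have "of_nat (dim (wsp \<alpha>)) * \<alpha> (smul c x) = of_nat (dim (wsp \<alpha>)) * (c * \<alpha> x)"
    using trace_wsp[OF subspace_wsp subset_refl] wsp_inv x subspace_scale[OF subspace_H x]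
    by simp
  then show ?thesis using dim_weight_pos[OF a] by (simp del: dim_eq_0)
qed

lemma weight_bracket:
  assumes a: "\<alpha> \<in> weights" and x: "x \<in> H" and y: "y \<in> H"
  shows "\<alpha> (br x y) = 0"
proof -
  have "trace (wsp \<alpha>) (br (br x y)) = 0"
    by (rule trace_bracket[OF subspace_wsp wsp_inv[OF x] wsp_inv[OF y]])
  then show ?thesis
    using trace_wsp[OF subspace_wsp subset_refl br_H[OF x y] wsp_inv[OF br_H[OF x y]], of \<alpha>]
      dim_weight_pos[OF a] by (simp del: dim_eq_0)
qed

text \<open>The trace of \<open>ad [x, y]\<close> vanishes on the sum of the weight spaces of the \<open>\<alpha>\<close>-string through \<open>\<beta>\<close>.\<close>

lemma string_rational:
  assumes \<alpha>: "supp_H \<alpha>" and x: "x \<in> wsp \<alpha>" and y: "y \<in> wsp (\<lambda>h. - \<alpha> h)" and h: "br x y \<in> H"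
    and \<beta>: "\<beta> \<in> weights"
  obtains q :: rat where "\<beta> (br x y) = of_rat q * \<alpha> (br x y)"
proof -
  define S where "S = {\<gamma> \<in> weights. \<exists>i::int. \<forall>h. \<gamma> h = \<beta> h + of_int i * \<alpha> h}"
  let ?V = "span (\<Union>\<gamma>\<in>S. wsp \<gamma>)"
  have finS: "finite S" unfolding S_def using finite_weights by simp
  have sup\<beta>: "supp_H \<beta>" using \<beta> by (rule weights_supp)
  have shift: "br z v \<in> ?V"
    if z: "z \<in> wsp (\<lambda>h. of_int j * \<alpha> h)" and v: "v \<in> ?V" for z v and j :: int
  proof (rule lin_span_into[OF lin_br _ subspace_span v])
    fix u assume "u \<in> (\<Union>\<gamma>\<in>S. wsp \<gamma>)"
    then obtain \<gamma> i where u: "\<gamma> \<in> S" "u \<in> wsp \<gamma>" and i: "\<And>h. \<gamma> h = \<beta> h + of_int i * \<alpha> h"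
      unfolding S_def by blast
    let ?\<delta> = "\<lambda>h. \<beta> h + of_int (i + j) * \<alpha> h"
    have "(\<lambda>h. of_int j * \<alpha> h + \<gamma> h) = ?\<delta>" by (rule ext) (simp add: i algebra_simps)
    then have m: "br z u \<in> wsp ?\<delta>" using wsp_bracket[OF z u(2)] by simp
    show "br z u \<in> ?V"
    proof (cases "br z u = 0")
      case True
      then show ?thesis using span_zero by simp
    next
      case False
      have "supp_H ?\<delta>" using \<alpha> sup\<beta> unfolding supp_H_def by simp
      then have "?\<delta> \<in> S" unfolding S_def weights_def using m False by blast
      then show ?thesis using m by (intro span_base) blast
    qed
  qed
  have "trace ?V (br (br x y)) = 0"
  proof (rule trace_bracket[OF subspace_span])
    show "br x v \<in> ?V" if "v \<in> ?V" for v using shift[of x 1 v] x that by simp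
    show "br y v \<in> ?V" if "v \<in> ?V" for v using shift[of y "-1" v] y that by simp
  qed
  moreover have "trace ?V (br (br x y)) = (\<Sum>\<gamma>\<in>S. trace (wsp \<gamma>) (br (br x y)))"
    by (rule trace_weight_sum[OF finS])
      (use weights_supp subspace_wsp lin_br wsp_inv[OF h] in \<open>auto simp: S_def\<close>)
  ultimately have sum0: "(\<Sum>\<gamma>\<in>S. of_nat (dim (wsp \<gamma>)) * \<gamma> (br x y)) = 0"
    using trace_wsp[OF subspace_wsp subset_refl h wsp_inv[OF h]] by simp
  have "\<exists>i. \<forall>\<gamma>\<in>S. \<forall>h. \<gamma> h = \<beta> h + of_int (i \<gamma>) * \<alpha> h"
    unfolding S_def by (intro bchoice) blast
  then obtain i :: "('v \<Rightarrow> 'k) \<Rightarrow> int" where i: "\<And>\<gamma>. \<gamma> \<in> S \<Longrightarrow> \<gamma> (br x y) = \<beta> (br x y) + of_int (i \<gamma>) * \<alpha> (br x y)"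
    by blast
  \<comment> \<open>With t = [x, y], the vanishing trace reads
    \<open>M * \<beta> t + N * \<alpha> t = 0\<close>. Here \<open>M\<close> is the dimension of the
    string space, positive because \<open>\<beta>\<close> belongs to \<open>S\<close>.\<close>
  define M where "M = (\<Sum>\<gamma>\<in>S. dim (wsp \<gamma>))"
  define N where "N = (\<Sum>\<gamma>\<in>S. int (dim (wsp \<gamma>)) * i \<gamma>)"
  have "(\<Sum>\<gamma>\<in>S. of_nat (dim (wsp \<gamma>)) * \<gamma> (br x y))
      = of_nat M * \<beta> (br x y) + of_int N * \<alpha> (br x y)"
    unfolding M_def N_def
    by (simp add: i distrib_left sum.distrib sum_distrib_right mult.assoc)
  then have eq: "of_nat M * \<beta> (br x y) = - of_int N * \<alpha> (br x y)"
    using sum0 by (simp add: eq_neg_iff_add_eq_0)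
  have "\<beta> \<in> S" unfolding S_def using \<beta> by (auto intro: exI[of _ 0])
  then have "M > 0" unfolding M_def
    using member_le_sum[of \<beta> S "\<lambda>\<gamma>. dim (wsp \<gamma>)"] finS dim_weight_pos[OF \<beta>] by simp
  then have "\<beta> (br x y) = of_rat (- of_int N / of_nat M) * \<alpha> (br x y)"
    using eq by (simp add: of_rat_divide of_rat_minus field_simps)
  then show ?thesis by (rule that)
qed

end

section \<open>The Killing form and root spaces\<close>

context fd_lie_algebra
begin

definition killing :: "'v \<Rightarrow> 'v \<Rightarrow> 'k" where
  "killing x y = trace UNIV (\<lambda>v. br x (br y v))"

lemma killing_sym: "killing x y = killing y x"
  unfolding killing_def by (rule trace_swap) (simp_all add: lin_br)

lemma killing_add_left: "killing (x + y) z = killing x z + killing y z"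
  unfolding killing_def br_add_left
  by (rule trace_add) (simp_all add: lin_compose[OF lin_br lin_br])

lemma killing_scale_left: "killing (smul a x) z = a * killing x z"
  unfolding killing_def br_scale_left
  by (rule trace_scaled) (simp_all add: lin_compose[OF lin_br lin_br])

lemma killing_0_left: "killing 0 z = 0"
  using killing_scale_left[of 0 0 z] by simp

lemma killing_diff_left: "killing (x - y) z = killing x z - killing y z"
  using killing_add_left[of "x - y" y z] by simp

lemma killing_uminus_left: "killing (- x) z = - killing x z"
  using killing_diff_left[of 0 x z] by (simp add: killing_0_left)

lemma killing_add_right: "killing z (x + y) = killing z x + killing z y"
  and killing_scale_right: "killing z (smul a x) = a * killing z x"
  and killing_0_right: "killing z 0 = 0"
  and killing_diff_right: "killing z (x - y) = killing z x - killing z y"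
  by (simp_all add: killing_sym[of z] killing_add_left killing_scale_left killing_0_left
      killing_diff_left)

lemma killing_invariant: "killing (br x y) z = killing x (br y z)"
proof -
  note l3 = lin_compose[OF lin_br lin_compose[OF lin_br lin_br]]
  have "killing (br x y) z = trace UNIV (\<lambda>v. br x (br y (br z v)) - br y (br x (br z v)))"
    unfolding killing_def by (simp add: br_jacobi[of x y])
  also have "\<dots> = trace UNIV (\<lambda>v. br x (br y (br z v))) - trace UNIV (\<lambda>v. br y (br x (br z v)))"
    by (rule trace_diff) (simp_all add: l3)
  also have "trace UNIV (\<lambda>v. br y (br x (br z v))) = trace UNIV (\<lambda>v. br x (br z (br y v)))"
    by (rule trace_swap) (simp_all add: lin_br lin_compose[OF lin_br lin_br])
  also have "trace UNIV (\<lambda>v. br x (br y (br z v))) - \<dots>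
      = trace UNIV (\<lambda>v. br x (br y (br z v)) - br x (br z (br y v)))"
    by (rule trace_diff[symmetric]) (simp_all add: l3)
  also have "\<dots> = killing x (br y z)"
    unfolding killing_def by (simp add: br_jacobi[of y z] lin_add[OF lin_br])
  finally show ?thesis .
qed

lemma killing_skew: "killing (br h x) y = - killing x (br h y)"
proof -
  have "killing (br h x) y = killing (- br x h) y" using br_skew[of h x] by simp
  then show ?thesis by (simp add: killing_uminus_left killing_invariant)
qed

text \<open>Invariance makes \<open>ad h\<close> skew for the form, so pairing
  \<open>(ad h - a) x\<close> with \<open>y\<close> and \<open>x\<close> with
  \<open>(ad h - b) y\<close> gives a total of \<open>- (a + b) * killing x y\<close>. Both pairings
  vanish by induction on the sum of the exponents.\<close>

lemma killing_gen_eig: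
  assumes "x \<in> gen_eig (br h) a" "y \<in> gen_eig (br h) b" "a + b \<noteq> 0"
  shows "killing x y = 0"
proof -
  define D where "D c v = br h v - smul c v" for c v
  have ge: "gen_eig (br h) c = {v. \<exists>n. (D c ^^ n) v = 0}" for c
    by (simp add: gen_eig_def D_def[abs_def])
  have *: "\<lbrakk>(D a ^^ p) x = 0; (D b ^^ q) y = 0\<rbrakk> \<Longrightarrow> killing x y = 0"
    if "p + q = n" for n p q x y
    using that
  proof (induction n arbitrary: p q x y rule: less_induct)
    case (less n)
    show ?case
    proof (cases "p = 0 \<or> q = 0")
      case True
      then have "x = 0 \<or> y = 0" using less.prems by auto
      then show ?thesis by (auto simp: killing_0_left killing_0_right)
    next
      case False
      then obtain p' q' where pq: "p = Suc p'" "q = Suc q'" using not0_implies_Suc by blast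
      have "killing (D a x) y = 0"
      proof (rule less.IH)
        show "p' + q < n" using less.prems(3) pq by simp
        show "(D a ^^ p') (D a x) = 0"
          using less.prems(1) by (simp add: pq funpow_swap1)
        show "(D b ^^ q) y = 0" by (rule less.prems(2))
      qed simp
      moreover have "killing x (D b y) = 0"
      proof (rule less.IH)
        show "p + q' < n" using less.prems(3) pq by simp
        show "(D b ^^ q') (D b y) = 0"
          using less.prems(2) by (simp add: pq funpow_swap1)
        show "(D a ^^ p) x = 0" by (rule less.prems(1))
      qed simp
      moreover have "killing (D a x) y + killing x (D b y) = - ((a + b) * killing x y)"
        unfolding D_def killing_diff_left killing_diff_right killing_scale_left killing_scale_right
          killing_skew by (simp add: algebra_simps)
      ultimately show ?thesis using assms(3) by simp
    qed
  qed
  obtain p q where "(D a ^^ p) x = 0" "(D b ^^ q) y = 0" using assms unfolding ge by blast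
  then show ?thesis using * by blast
qed

text \<open>Factor \<open>f^2 - c^2 = (f + c) (f - c)\<close> into commuting maps. This gives the
  trace of the square of \<open>ad h\<close> on a weight space.\<close>

lemma gen_eig_square:
  assumes f: "lin f" and v: "v \<in> gen_eig f c"
  shows "v \<in> gen_eig (\<lambda>v. f (f v)) (c\<^sup>2)"
proof -
  define D where "D = (\<lambda>v. f v - smul c v)"
  have D: "lin D" unfolding D_def by (rule lin_shift[OF f])
  have comm: "(D ^^ n) (f w) = f ((D ^^ n) w)" for n w
  proof (induction n)
    case (Suc n)
    then show ?case by (simp add: D_def lin_diff[OF f] lin_scale[OF f])
  qed simp
  have "(D ^^ n) v = 0 \<Longrightarrow> v \<in> gen_eig (\<lambda>v. f (f v)) (c\<^sup>2)" for n v
  proof (induction n arbitrary: v)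
    case 0
    then show ?case using subspace_0[OF subspace_gen_eig[OF lin_compose[OF f f]]] by simp
  next
    case (Suc n)
    have "(D ^^ n) (D v) = 0" using Suc.prems by (simp add: funpow_swap1)
    then have "(D ^^ n) (f (D v) + smul c (D v)) = 0"
      by (simp add: lin_add[OF lin_funpow[OF D]] lin_scale[OF lin_funpow[OF D]] comm lin_zero[OF f])
    moreover have "f (D v) + smul c (D v) = f (f v) - smul (c\<^sup>2) v"
      by (simp add: D_def lin_diff[OF f] lin_scale[OF f] scale_right_diff_distrib power2_eq_square)
    ultimately show ?case using Suc.IH gen_eig_step by metis
  qed
  then show ?thesis using v unfolding gen_eig_def D_def by blast
qed

end

section \<open>Cartan's criterion and the Killing form of a simple algebra\<close>

locale simple_cartan = nilpotent_action smul Basis br H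
  for smul :: "'k::field_char_0 \<Rightarrow> 'v::ab_group_add \<Rightarrow> 'v" and Basis br H +
  assumes simple: "simple_lie_algebra smul br"
    and cartan: "cartan_subalgebra smul br H"
begin

text \<open>Otherwise Engel's theorem on the zero weight space, taken modulo \<open>H\<close>,
  yields a vector outside \<open>H\<close> that normalizes \<open>H\<close>.\<close>

lemma wsp_0: "wsp (\<lambda>_. 0) = H"
proof (rule ccontr)
  assume "wsp (\<lambda>_. 0) \<noteq> H"
  then have ex: "\<exists>v. v \<in> wsp (\<lambda>_. 0) - H" using H_subset_wsp_0 by blast
  have "\<exists>v\<in>wsp (\<lambda>_. 0) - H. \<forall>x\<in>H. br x v \<in> H"
  proof (rule engel[OF _ _ _ _ subspace_H br_H wsp_inv ex])
    fix x v assume "x \<in> H" "v \<in> wsp (\<lambda>_. 0)"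
    then have "v \<in> gen_eig (br x) 0" unfolding wsp_def by blast
    then show "\<exists>n. (br x ^^ n) v = 0" by (simp add: gen_eig_def)
  next
    fix x y v show "br (br x y) v = br x (br y v) - br y (br x v)" by (simp add: br_jacobi[of x y])
  qed (simp_all add: br_add_left br_scale_left lin_br)
  then obtain v where v: "v \<notin> H" "\<And>x. x \<in> H \<Longrightarrow> br x v \<in> H" by blast
  have "br v x \<in> H" if "x \<in> H" for x
    using subspace_neg[OF subspace_H v(2)[OF that]] br_skew[of v x] by simp
  then have "v \<in> H" using cartan unfolding cartan_subalgebra_def by blast
  then show False using v(1) by blast
qed

lemma span_weights: "span (\<Union>\<gamma>\<in>weights. wsp \<gamma>) = UNIV"
  using weight_decomposition by blast

lemma killing_square:
  assumes h: "h \<in> H"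
  shows "killing h h = (\<Sum>\<gamma>\<in>weights. of_nat (dim (wsp \<gamma>)) * (\<gamma> h)\<^sup>2)"
proof -
  let ?f = "\<lambda>v. br h (br h v)"
  have "killing h h = trace (span (\<Union>\<gamma>\<in>weights. wsp \<gamma>)) ?f"
    by (simp only: killing_def span_weights)
  also have "\<dots> = (\<Sum>\<gamma>\<in>weights. trace (wsp \<gamma>) ?f)"
    by (rule trace_weight_sum[OF finite_weights])
      (simp_all add: weights_supp subspace_wsp lin_compose[OF lin_br lin_br] wsp_inv[OF h])
  also have "\<dots> = (\<Sum>\<gamma>\<in>weights. of_nat (dim (wsp \<gamma>)) * (\<gamma> h)\<^sup>2)"
  proof (rule sum.cong[OF refl], rule trace_single_eigenvalue[OF subspace_wsp lin_compose[OF lin_br lin_br]])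
    fix \<gamma> v assume "v \<in> wsp \<gamma>"
    then show "?f v \<in> wsp \<gamma>" by (intro wsp_inv[OF h])
    have "v \<in> gen_eig (br h) (\<gamma> h)" using \<open>v \<in> wsp \<gamma>\<close> h unfolding wsp_def by blast
    from gen_eig_square[OF lin_br this]
    show "\<exists>n. ((\<lambda>v. ?f v - smul ((\<gamma> h)\<^sup>2) v) ^^ n) v = 0" unfolding gen_eig_def by blast
  qed
  finally show ?thesis .
qed

text \<open>Polarization of \<open>killing_square\<close> avoids treating \<open>ad x\<close> and
  \<open>ad y\<close> simultaneously; 2 is invertible in characteristic 0.\<close>

lemma killing_H:
  assumes x: "x \<in> H" and y: "y \<in> H"
  shows "killing x y = (\<Sum>\<gamma>\<in>weights. of_nat (dim (wsp \<gamma>)) * (\<gamma> x * \<gamma> y))"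
proof -
  have "killing (x + y) (x + y) = killing x x + 2 * killing x y + killing y y"
    by (simp add: killing_add_left killing_add_right killing_sym[of y x])
  moreover have "killing (x + y) (x + y) = (\<Sum>\<gamma>\<in>weights. of_nat (dim (wsp \<gamma>)) * (\<gamma> x + \<gamma> y)\<^sup>2)"
    unfolding killing_square[OF subspace_add[OF subspace_H x y]]
    by (rule sum.cong) (simp_all add: weight_add x y)
  moreover have "\<dots> = killing x x + 2 * (\<Sum>\<gamma>\<in>weights. of_nat (dim (wsp \<gamma>)) * (\<gamma> x * \<gamma> y)) + killing y y"
    unfolding killing_square[OF x] killing_square[OF y] sum_distrib_left sum.distrib[symmetric]
    by (rule sum.cong) (simp_all add: power2_sum algebra_simps)
  ultimately have "2 * killing x y = 2 * (\<Sum>\<gamma>\<in>weights. of_nat (dim (wsp \<gamma>)) * (\<gamma> x * \<gamma> y))"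
    by simp
  then show ?thesis by simp
qed

lemma killing_orthogonal:
  assumes "x \<in> wsp \<alpha>" "y \<in> wsp \<beta>" "h \<in> H" "\<alpha> h + \<beta> h \<noteq> 0"
  shows "killing x y = 0"
  using assms killing_gen_eig[of x h "\<alpha> h" y "\<beta> h"] unfolding wsp_def by blast

lemma derived_UNIV: "span {br x y |x y. True} = UNIV"
proof -
  let ?I = "span {br x y |x y. True}"
  have "lie_ideal smul br ?I" unfolding lie_ideal_def
  proof (intro conjI allI impI)
    show "br x y \<in> ?I" for x y by (intro span_base) blast
  qed (rule subspace_span)
  then have "?I = {0} \<or> ?I = UNIV" using simple unfolding simple_lie_algebra_def by blast
  moreover obtain x y where "br x y \<noteq> 0" using simple unfolding simple_lie_algebra_def by blast
  moreover have "br x y \<in> ?I" by (intro span_base) blast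
  ultimately show ?thesis by blast
qed

text \<open>If all weights vanished on \<open>H\<close>, then \<open>H\<close> would be the whole
  algebra, which would be nilpotent and yet equal to its derived algebra.\<close>

lemma weight_nonzero_ex: "\<exists>h\<in>H. \<exists>\<gamma>\<in>weights. \<gamma> h \<noteq> 0"
proof (rule ccontr)
  assume no: "\<not> ?thesis"
  have "wsp \<gamma> \<subseteq> H" if "\<gamma> \<in> weights" for \<gamma>
    using wsp_cong[of \<gamma> "\<lambda>_. 0"] no that wsp_0 by auto
  then have "span (\<Union>\<gamma>\<in>weights. wsp \<gamma>) \<subseteq> H" by (intro span_minimal subspace_H) blast
  then have HU: "H = UNIV" using span_weights by blast
  have "lcs smul br H n = UNIV" for n
  proof (induction n)
    case (Suc n)
    have "{br x y |x y. x \<in> H \<and> y \<in> lcs smul br H n} = {br x y |x y. True}"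
      using Suc HU by simp
    then show ?case using derived_UNIV by simp
  qed (simp add: HU)
  moreover obtain n where "lcs smul br H n = {0}" using lcs_H by blast
  ultimately have "br x y = 0" for x y by (metis UNIV_I singletonD)
  then show False using simple unfolding simple_lie_algebra_def by blast
qed

lemma opposite_bracket_in_H:
  assumes "x \<in> wsp \<alpha>" "y \<in> wsp (\<lambda>h. - \<alpha> h)" shows "br x y \<in> H"
  using wsp_bracket[OF assms] by (simp add: wsp_0)

lemma opposite_bracket_vanish:
  assumes \<alpha>: "supp_H \<alpha>" and x: "x \<in> wsp \<alpha>" and y: "y \<in> wsp (\<lambda>h. - \<alpha> h)"
    and 0: "\<alpha> (br x y) = 0" and \<gamma>: "\<gamma> \<in> weights"
  shows "\<gamma> (br x y) = 0"
  using string_rational[OF \<alpha> x y opposite_bracket_in_H[OF x y] \<gamma>] 0 by auto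

text \<open>For t = [x, y], rationality along strings gives
  \<open>killing t t = Q * (\<alpha> t)^2\<close>, with \<open>Q\<close> a sum of rational squares
  weighted by dimensions. If \<open>\<alpha> t\<close> were nonzero, the weight
  \<open>\<alpha>\<close> itself would have ratio 1 and make \<open>Q\<close> positive.\<close>

lemma isotropic_bracket_vanish:
  assumes \<alpha>: "\<alpha> \<in> weights" and x: "x \<in> wsp \<alpha>" and y: "y \<in> wsp (\<lambda>h. - \<alpha> h)"
    and K: "killing (br x y) (br x y) = 0" and \<gamma>: "\<gamma> \<in> weights"
  shows "\<gamma> (br x y) = 0"
proof -
  let ?h = "br x y"
  have h: "?h \<in> H" by (rule opposite_bracket_in_H[OF x y])
  have "\<exists>q. \<forall>\<beta>\<in>weights. \<beta> ?h = of_rat (q \<beta>) * \<alpha> ?h"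
    using string_rational[OF weights_supp[OF \<alpha>] x y h] by (intro bchoice) metis
  then obtain q :: "('v \<Rightarrow> 'k) \<Rightarrow> rat" where q: "\<And>\<beta>. \<beta> \<in> weights \<Longrightarrow> \<beta> ?h = of_rat (q \<beta>) * \<alpha> ?h"
    by blast
  define Q where "Q = (\<Sum>\<beta>\<in>weights. of_nat (dim (wsp \<beta>)) * (q \<beta>)\<^sup>2)"
  have "killing ?h ?h = of_rat Q * (\<alpha> ?h)\<^sup>2"
    unfolding killing_square[OF h] Q_def of_rat_sum sum_distrib_right
    by (rule sum.cong) (simp_all add: q of_rat_mult of_rat_power power_mult_distrib)
  then have alt: "Q = 0 \<or> \<alpha> ?h = 0" using K by simp
  have "\<alpha> ?h = 0"
  proof (rule ccontr)
    assume nz: "\<alpha> ?h \<noteq> 0"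
    then have "of_rat (q \<alpha>) = (1 :: 'k)" using q[OF \<alpha>] by simp
    then have "q \<alpha> = 1" by (metis of_rat_eq_1_iff)
    then have "0 < of_nat (dim (wsp \<alpha>)) * (q \<alpha>)\<^sup>2" using dim_weight_pos[OF \<alpha>] by simp
    also have "\<dots> \<le> Q" unfolding Q_def
      by (rule member_le_sum[OF \<alpha>]) (simp_all add: finite_weights)
    finally show False using alt nz by simp
  qed
  then show ?thesis by (rule opposite_bracket_vanish[OF weights_supp[OF \<alpha>] x y _ \<gamma>])
qed

text \<open>Cartan's criterion for a simple algebra: were the Killing form zero, all weights would vanish on
\<open>[\<gg>\<^sub>\<alpha>, \<gg>\<^sub>-\<^sub>\<alpha>]\<close>, hence on \<open>H\<close>, because the algebra is its own derived algebra.\<close>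

lemma killing_nonzero: "\<exists>x y. killing x y \<noteq> 0"
proof (rule ccontr)
  assume "\<not> ?thesis"
  then have K: "killing x y = 0" for x y by blast
  define H0 where "H0 = {h \<in> H. \<forall>\<gamma>\<in>weights. \<gamma> h = 0}"
  define P where "P = weights - {\<lambda>_. 0}"
  have \<gamma>0: "\<gamma> 0 = 0" if "\<gamma> \<in> weights" for \<gamma>
    using weight_scale[OF that subspace_0[OF subspace_H], of 0] by simp
  have sH0: "subspace H0" unfolding H0_def
    by (rule subspaceI)
      (auto simp: \<gamma>0 weight_add weight_scale subspace_0[OF subspace_H] subspace_add[OF subspace_H]
        subspace_scale[OF subspace_H])
  \<comment> \<open>The whole algebra with \<open>H\<close> shrunk to \<open>H0\<close>. It contains
    every bracket: only opposite weights, zero with itself included, have brackets in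
    \<open>H\<close>, and those lie in \<open>H0\<close> because the form is zero.\<close>
  let ?M = "span (H0 \<union> (\<Union>\<gamma>\<in>P. wsp \<gamma>))"
  have wM: "br x y \<in> ?M" if \<alpha>: "\<alpha> \<in> weights" and \<beta>: "\<beta> \<in> weights" and x: "x \<in> wsp \<alpha>" and y: "y \<in> wsp \<beta>"
    for x y \<alpha> \<beta>
  proof (cases "br x y = 0")
    case True
    then show ?thesis using span_zero by simp
  next
    case False
    let ?\<delta> = "\<lambda>h. \<alpha> h + \<beta> h"
    have m: "br x y \<in> wsp ?\<delta>" by (rule wsp_bracket[OF x y])
    have "supp_H ?\<delta>" using weights_supp[OF \<alpha>] weights_supp[OF \<beta>] unfolding supp_H_def by simp
    then have w: "?\<delta> \<in> weights" using m False unfolding weights_def by blast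
    show ?thesis
    proof (cases "?\<delta> = (\<lambda>_. 0)")
      case True
      then have "\<beta> h = - \<alpha> h" for h by (metis add_eq_0_iff)
      then have y': "y \<in> wsp (\<lambda>h. - \<alpha> h)" using y by presburger
      have "br x y \<in> H0" unfolding H0_def
        using opposite_bracket_in_H[OF x y'] isotropic_bracket_vanish[OF \<alpha> x y' K] by simp
      then show ?thesis by (intro span_base) blast
    next
      case False
      then have "?\<delta> \<in> P" using w unfolding P_def by simp
      then show ?thesis using m by (intro span_base) blast
    qed
  qed
  have brM: "br x y \<in> ?M" for x y
  proof (rule lin_span_into[OF lin_br _ subspace_span weight_decomposition])
    fix y assume "y \<in> (\<Union>\<gamma>\<in>weights. wsp \<gamma>)"
    then obtain \<beta> where \<beta>: "\<beta> \<in> weights" "y \<in> wsp \<beta>" by blast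
    show "br x y \<in> ?M"
    proof (rule lin_span_into[OF lin_br_left _ subspace_span weight_decomposition])
      fix x assume "x \<in> (\<Union>\<gamma>\<in>weights. wsp \<gamma>)"
      then show "br x y \<in> ?M" using wM \<beta> by blast
    qed
  qed
  have "span {br x y |x y. True} \<subseteq> ?M" by (intro span_minimal subspace_span) (use brM in blast)
  then have M: "?M = UNIV" using derived_UNIV by blast
  \<comment> \<open>By independence of the weight spaces, an element of \<open>H\<close> has no
    component in those of nonzero weight, so shrinking \<open>H\<close> changed nothing.\<close>
  have "h \<in> H0" if h: "h \<in> H" for h
  proof -
    have "h \<in> ?M" using M by blast
    then obtain a b where ab: "h = a + b" "a \<in> span H0" "b \<in> span (\<Union>\<gamma>\<in>P. wsp \<gamma>)"
      by (rule span_Un_cases)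
    have a: "a \<in> H0" using ab(2) span_eq_iff[THEN iffD2, OF sH0] by simp
    then have "b \<in> H" using subspace_diff[OF subspace_H h, of a] unfolding ab(1) H0_def by simp
    then have "b \<in> wsp (\<lambda>_. 0)" by (simp add: wsp_0)
    moreover have "finite P" "\<And>\<gamma>. \<gamma> \<in> P \<Longrightarrow> supp_H \<gamma>" "supp_H (\<lambda>_. 0)" "(\<lambda>_. 0) \<notin> P"
      using finite_weights weights_supp by (simp_all add: P_def supp_H_def)
    ultimately have "b = 0" using wsp_disjoint ab(3) by blast
    then show "h \<in> H0" using a ab(1) by simp
  qed
  then show False using weight_nonzero_ex unfolding H0_def by blast
qed

text \<open>The radical of the form is an ideal by invariance, and it is proper by Cartan's
  criterion.\<close>

lemma killing_nondegenerate:
  assumes "\<And>y. killing x y = 0" shows "x = 0"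
proof -
  let ?R = "{x. \<forall>y. killing x y = 0}"
  have "lie_ideal smul br ?R" unfolding lie_ideal_def
  proof (intro conjI allI impI)
    show "subspace ?R"
      by (rule subspaceI) (simp_all add: killing_0_left killing_add_left killing_scale_left)
    show "br x y \<in> ?R" if "y \<in> ?R" for x y using that by (simp add: killing_skew)
  qed
  then have "?R = {0} \<or> ?R = UNIV" using simple unfolding simple_lie_algebra_def by blast
  moreover have "?R \<noteq> UNIV" using killing_nonzero by blast
  ultimately show ?thesis using assms by blast
qed

lemma killing_dual_weight:
  assumes "x \<noteq> 0"
  obtains \<beta> y where "\<beta> \<in> weights" "y \<in> wsp \<beta>" "killing x y \<noteq> 0"
proof (rule ccontr)
  assume "\<not> thesis"
  then have no: "\<And>\<beta> y. \<beta> \<in> weights \<Longrightarrow> y \<in> wsp \<beta> \<Longrightarrow> killing x y = 0" using that by blast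
  have "killing x y = 0" for y
  proof -
    have "y \<in> {y. killing x y = 0}"
    proof (rule span_induct_lin[OF weight_decomposition])
      show "subspace {y. killing x y = 0}"
        by (rule subspaceI) (simp_all add: killing_0_right killing_add_right killing_scale_right)
    qed (use no in blast)
    then show ?thesis by simp
  qed
  then show False using killing_nondegenerate assms by blast
qed

text \<open>Such an \<open>h\<close> is orthogonal to weight spaces of nonzero weight because the
  weights do not cancel, and to \<open>H\<close> by the formula for the form as a sum over weights.
  Nondegeneracy leaves only \<open>h = 0\<close>.\<close>

lemma weights_separate:
  assumes h: "h \<in> H" and 0: "\<And>\<gamma>. \<gamma> \<in> weights \<Longrightarrow> \<gamma> h = 0"
  shows "h = 0"
proof (rule ccontr)
  assume "h \<noteq> 0"
  then obtain \<beta> y where \<beta>: "\<beta> \<in> weights" "y \<in> wsp \<beta>" "killing h y \<noteq> 0"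
    by (rule killing_dual_weight)
  have "\<beta> k = 0" if "k \<in> H" for k
    using killing_orthogonal[of h "\<lambda>_. 0" y \<beta> k] h \<beta> that wsp_0 by auto
  then have "y \<in> H" using wsp_cong[of \<beta> "\<lambda>_. 0"] \<beta>(2) wsp_0 by simp
  then have "killing h y = 0" unfolding killing_H[OF h \<open>y \<in> H\<close>] by (intro sum.neutral) (simp add: 0)
  then show False using \<beta>(3) by simp
qed

section \<open>One-dimensionality of the root spaces\<close>

definition nonzero_weights :: "('v \<Rightarrow> 'k) set" where
  "nonzero_weights = {\<alpha> \<in> weights. \<exists>h\<in>H. \<alpha> h \<noteq> 0}"

lemma nonzero_weightsD: "\<alpha> \<in> nonzero_weights \<Longrightarrow> \<alpha> \<in> weights"
  by (simp add: nonzero_weights_def)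

text \<open>As a weight is linear and vanishes on brackets, \<open>ad h - \<alpha> h\<close> is an
  action of \<open>H\<close>. It is nilpotent on the weight space, so Engel's theorem modulo zero
  produces a genuine common eigenvector.\<close>

lemma weight_vector:
  assumes \<alpha>: "\<alpha> \<in> weights"
  obtains e where "e \<in> wsp \<alpha>" "e \<noteq> 0" "\<And>h. h \<in> H \<Longrightarrow> br h e = smul (\<alpha> h) e"
proof -
  let ?\<rho> = "\<lambda>h v. br h v - smul (\<alpha> h) v"
  have ex: "\<exists>v. v \<in> wsp \<alpha> - {0}"
    using \<alpha> subspace_0[OF subspace_wsp] unfolding weights_def by blast
  have "\<exists>v\<in>wsp \<alpha> - {0}. \<forall>x\<in>H. ?\<rho> x v \<in> {0}"
  proof (rule engel[OF _ _ _ _ subspace_single_0 _ _ ex])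
    fix x y v assume x: "x \<in> H"
    show "?\<rho> (smul a x) v = smul a (?\<rho> x v)" for a
      by (simp add: br_scale_left weight_scale[OF \<alpha> x] scale_right_diff_distrib)
    show "lin (?\<rho> x)" by (rule lin_shift[OF lin_br])
    show "?\<rho> x v \<in> {0}" if "v \<in> {0}" using that by (simp add: br_0_right)
    show "?\<rho> x v \<in> wsp \<alpha>" if "v \<in> wsp \<alpha>"
      by (intro subspace_diff subspace_scale subspace_wsp wsp_inv x that)
    show "\<exists>n. (?\<rho> x ^^ n) v = 0" if "v \<in> wsp \<alpha>"
      using that x unfolding wsp_def gen_eig_def by blast
    assume y: "y \<in> H"
    show "?\<rho> (x + y) v = ?\<rho> x v + ?\<rho> y v"
      by (simp add: br_add_left weight_add[OF \<alpha> x y] scale_left_distrib)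
    show "?\<rho> (br x y) v = ?\<rho> x (?\<rho> y v) - ?\<rho> y (?\<rho> x v)"
      by (simp add: weight_bracket[OF \<alpha> x y] br_jacobi[of x y] lin_diff[OF lin_br]
          lin_scale[OF lin_br] scale_right_diff_distrib mult.commute)
  qed
  then obtain e where "e \<in> wsp \<alpha>" "e \<noteq> 0" "\<And>x. x \<in> H \<Longrightarrow> ?\<rho> x e = 0" by blast
  then show ?thesis using that by simp
qed

text \<open>Nondegeneracy supplies a partner of \<open>e\<close>, which may be taken in a weight
  space; orthogonality forces its weight to be opposite.\<close>

lemma opposite_weight:
  assumes \<alpha>: "\<alpha> \<in> weights" and e: "e \<in> wsp \<alpha>" "e \<noteq> 0"
  obtains y where "y \<in> wsp (\<lambda>h. - \<alpha> h)" "killing e y \<noteq> 0" "(\<lambda>h. - \<alpha> h) \<in> weights"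
proof -
  obtain \<beta> y where \<beta>: "\<beta> \<in> weights" "y \<in> wsp \<beta>" "killing e y \<noteq> 0"
    using e(2) by (rule killing_dual_weight)
  have "\<beta> h = - \<alpha> h" for h
  proof (cases "h \<in> H")
    case True
    then have "\<alpha> h + \<beta> h = 0" using killing_orthogonal[OF e(1) \<beta>(2)] \<beta>(3) by blast
    then show ?thesis by (simp add: add_eq_0_iff)
  next
    case False
    then show ?thesis using weights_supp[OF \<alpha>] weights_supp[OF \<beta>(1)] by (simp add: supp_H_def)
  qed
  then have "\<beta> = (\<lambda>h. - \<alpha> h)" by (rule ext)
  then show ?thesis using that \<beta> by blast
qed

text \<open>With \<open>t = [e, y]\<close>, the trace of \<open>ad t\<close> vanishes on
\<open>k e \<oplus> \<hh> \<oplus> \<gg>\<^sub>-\<^sub>\<alpha> \<oplus> \<gg>\<^sub>-\<^sub>2\<^sub>\<alpha> \<oplus> \<dots>\<close>, that is,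
\<open>1 - dim \<gg>\<^sub>-\<^sub>\<alpha> - 2 dim \<gg>\<^sub>-\<^sub>2\<^sub>\<alpha> - \<dots> = 0\<close>.\<close>

lemma dim_opposite_weight:
  assumes \<alpha>: "\<alpha> \<in> nonzero_weights"
  shows "dim (wsp (\<lambda>h. - \<alpha> h)) = 1"
proof -
  have \<alpha>w: "\<alpha> \<in> weights" using \<alpha> by (rule nonzero_weightsD)
  obtain h0 where h0: "h0 \<in> H" "\<alpha> h0 \<noteq> 0" using \<alpha> unfolding nonzero_weights_def by blast
  obtain e where e: "e \<in> wsp \<alpha>" "e \<noteq> 0" and eH: "\<And>h. h \<in> H \<Longrightarrow> br h e = smul (\<alpha> h) e"
    using weight_vector[OF \<alpha>w] by metis
  obtain y where y: "y \<in> wsp (\<lambda>h. - \<alpha> h)" and ey: "killing e y \<noteq> 0"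
    and neg: "(\<lambda>h. - \<alpha> h) \<in> weights"
    using opposite_weight[OF \<alpha>w e] by metis
  define t where "t = br e y"
  have tH: "t \<in> H" unfolding t_def by (rule opposite_bracket_in_H[OF e(1) y])
  \<comment> \<open>Invariance moves \<open>h0\<close> onto \<open>e\<close>, where it acts by a
    nonzero scalar; this shows that \<open>t\<close> is nonzero.\<close>
  have "killing h0 t = \<alpha> h0 * killing e y"
    unfolding t_def killing_invariant[symmetric] eH[OF h0(1)] by (rule killing_scale_left)
  then have "killing h0 t \<noteq> 0" using h0 ey by simp
  then have t0: "t \<noteq> 0" by (auto simp: killing_0_right)
  \<comment> \<open>If \<open>\<alpha>\<close> vanished at \<open>t\<close>, so would every weight,
    by the string argument, and \<open>t\<close> would be zero.\<close>
  have \<alpha>t: "\<alpha> t \<noteq> 0"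
    using weights_separate[OF tH] t0 opposite_bracket_vanish[OF weights_supp[OF \<alpha>w] e(1) y]
    unfolding t_def by blast
  \<comment> \<open>The chain of integer multiples \<open>i * \<alpha>\<close> is cut off above at
    \<open>i = 1\<close>, where only the line through \<open>e\<close> is kept.\<close>
  define S where "S = {\<gamma> \<in> weights. \<exists>i::int. i \<le> 1 \<and> (\<forall>h. \<gamma> h = of_int i * \<alpha> h)}"
  define U where "U \<gamma> = (if \<gamma> = \<alpha> then span {e} else wsp \<gamma>)" for \<gamma>
  have finS: "finite S" unfolding S_def using finite_weights by simp
  have sU: "subspace (U \<gamma>)" for \<gamma> by (simp add: U_def subspace_wsp)
  have "span {e} \<subseteq> wsp \<alpha>" by (rule span_minimal) (use e(1) subspace_wsp in auto)
  then have Uw: "U \<gamma> \<subseteq> wsp \<gamma>" for \<gamma> by (simp add: U_def)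
  let ?V = "span (\<Union>\<gamma>\<in>S. U \<gamma>)"
  have low: "u \<in> ?V" if u: "u \<in> wsp (\<lambda>h. of_int i * \<alpha> h)" and i: "i \<le> 0" for u and i :: int
  proof (cases "u = 0")
    case True
    then show ?thesis using span_zero by simp
  next
    case False
    let ?\<gamma> = "\<lambda>h. of_int i * \<alpha> h"
    have "supp_H ?\<gamma>" using weights_supp[OF \<alpha>w] by (simp add: supp_H_def)
    then have w: "?\<gamma> \<in> weights" using u False unfolding weights_def by blast
    have "?\<gamma> \<in> S" unfolding S_def using w i by (intro CollectI conjI exI[of _ i]) auto
    moreover have "?\<gamma> \<noteq> \<alpha>"
    proof
      assume "?\<gamma> = \<alpha>"
      then have "of_int i * \<alpha> h0 = \<alpha> h0" by (rule fun_cong)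
      then have "(of_int i :: 'k) = 1" using h0(2) by simp
      then show False using i by simp
    qed
    then have "u \<in> U ?\<gamma>" using u by (simp add: U_def)
    ultimately show ?thesis by (intro span_base) blast
  qed
  have \<alpha>S: "\<alpha> \<in> S" unfolding S_def using \<alpha>w by (intro CollectI conjI exI[of _ 1]) auto
  have eV: "e \<in> ?V"
  proof (rule span_base)
    have "e \<in> U \<alpha>" using span_base[of e "{e}"] by (simp add: U_def)
    then show "e \<in> (\<Union>\<gamma>\<in>S. U \<gamma>)" using \<alpha>S by blast
  qed
  \<comment> \<open>At the cut the span stays stable: \<open>e\<close> kills itself, and it sends
    \<open>H\<close> into its own line because it is a genuine eigenvector.\<close>
  have Ve: "br e v \<in> ?V" if v: "v \<in> ?V" for v
  proof (rule lin_span_into[OF lin_br _ subspace_span v])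
    fix u assume "u \<in> (\<Union>\<gamma>\<in>S. U \<gamma>)"
    then obtain \<gamma> i where u: "u \<in> U \<gamma>" and i: "i \<le> 1" "\<And>h. \<gamma> h = of_int i * \<alpha> h"
      unfolding S_def by blast
    show "br e u \<in> ?V"
    proof (cases "\<gamma> = \<alpha>")
      case True
      then obtain c where "u = smul c e" using u by (auto simp: U_def span_singleton)
      then show ?thesis by (simp add: br_scale_right br_self span_zero)
    next
      case False
      have "i \<noteq> 1" using False i(2) by (auto simp: fun_eq_iff)
      then have i0: "i \<le> 0" using i(1) by simp
      have u': "u \<in> wsp \<gamma>" using u Uw by blast
      show ?thesis
      proof (cases "i = 0")
        case True
        then have "\<gamma> = (\<lambda>_. 0)" using i(2) by (simp add: fun_eq_iff)
        then have "u \<in> H" using u' wsp_0 by simp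
        then have "br e u = smul (- \<alpha> u) e" using eH[of u] br_skew[of e u] by simp
        then show ?thesis using eV span_scale by metis
      next
        case False
        have "(\<lambda>h. \<alpha> h + \<gamma> h) = (\<lambda>h. of_int (i + 1) * \<alpha> h)"
          by (rule ext) (simp add: i(2) algebra_simps)
        then have "br e u \<in> wsp (\<lambda>h. of_int (i + 1) * \<alpha> h)" using wsp_bracket[OF e(1) u'] by simp
        then show ?thesis by (rule low) (use i0 False in simp)
      qed
    qed
  qed
  have Vy: "br y v \<in> ?V" if v: "v \<in> ?V" for v
  proof (rule lin_span_into[OF lin_br _ subspace_span v])
    fix u assume "u \<in> (\<Union>\<gamma>\<in>S. U \<gamma>)"
    then obtain \<gamma> i where u: "u \<in> U \<gamma>" and i: "i \<le> 1" "\<And>h. \<gamma> h = of_int i * \<alpha> h"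
      unfolding S_def by blast
    have "u \<in> wsp \<gamma>" using u Uw by blast
    moreover have "(\<lambda>h. - \<alpha> h + \<gamma> h) = (\<lambda>h. of_int (i - 1) * \<alpha> h)"
      by (rule ext) (simp add: i(2) algebra_simps)
    ultimately have "br y u \<in> wsp (\<lambda>h. of_int (i - 1) * \<alpha> h)" using wsp_bracket[OF y] by metis
    then show "br y u \<in> ?V" using low[of _ "i - 1"] i(1) by simp
  qed
  have Ut: "br t u \<in> U \<gamma>" if u: "u \<in> U \<gamma>" for \<gamma> u
  proof (cases "\<gamma> = \<alpha>")
    case True
    then obtain c where "u = smul c e" using u by (auto simp: U_def span_singleton)
    then have "br t u = smul (c * \<alpha> t) e" by (simp add: br_scale_right eH[OF tH])
    then show ?thesis using True span_scale[OF span_base[of e "{e}"]] by (simp add: U_def)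
  next
    case False
    then show ?thesis using u wsp_inv[OF tH] by (simp add: U_def)
  qed
  have "trace ?V (br t) = 0" unfolding t_def by (rule trace_bracket[OF subspace_span Ve Vy])
  moreover have "trace ?V (br t) = (\<Sum>\<gamma>\<in>S. trace (U \<gamma>) (br t))"
    by (rule trace_weight_sum[OF finS _ sU Uw lin_br Ut]) (simp_all add: S_def weights_supp)
  ultimately have sum0: "(\<Sum>\<gamma>\<in>S. of_nat (dim (U \<gamma>)) * \<gamma> t) = 0"
    using trace_wsp[OF sU Uw tH Ut] by simp
  have "\<exists>i. \<forall>\<gamma>\<in>S. i \<gamma> \<le> 1 \<and> (\<forall>h. \<gamma> h = of_int (i \<gamma>) * \<alpha> h)"
    unfolding S_def by (intro bchoice) blast
  then obtain i :: "('v \<Rightarrow> 'k) \<Rightarrow> int" where i1: "\<And>\<gamma>. \<gamma> \<in> S \<Longrightarrow> i \<gamma> \<le> 1"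
    and i: "\<And>\<gamma> h. \<gamma> \<in> S \<Longrightarrow> \<gamma> h = of_int (i \<gamma>) * \<alpha> h"
    by blast
  have "(\<Sum>\<gamma>\<in>S. of_nat (dim (U \<gamma>)) * \<gamma> t) = of_int (\<Sum>\<gamma>\<in>S. int (dim (U \<gamma>)) * i \<gamma>) * \<alpha> t"
    unfolding of_int_sum sum_distrib_right
    by (rule sum.cong) (simp_all add: i[of _ t] mult.assoc)
  with sum0 have "of_int (\<Sum>\<gamma>\<in>S. int (dim (U \<gamma>)) * i \<gamma>) * \<alpha> t = 0" by metis
  then have isum: "(\<Sum>\<gamma>\<in>S. int (dim (U \<gamma>)) * i \<gamma>) = 0"
    using \<alpha>t by (simp only: mult_eq_0_iff of_int_eq_0_iff simp_thms)
  have ival: "i \<gamma> = j" if "\<gamma> \<in> S" "\<gamma> h0 = of_int j * \<alpha> h0" for \<gamma> j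
    using i[OF that(1), of h0] that(2) h0(2) by simp
  have i\<alpha>: "i \<alpha> = 1" by (rule ival[OF \<alpha>S]) simp
  have Sdim: "int (dim (U \<gamma>)) * i \<gamma> \<le> 0" if "\<gamma> \<in> S - {\<alpha>}" for \<gamma>
  proof -
    have "i \<gamma> \<noteq> 1" using i[of \<gamma>] that by (auto simp: fun_eq_iff)
    then have "i \<gamma> \<le> 0" using i1[of \<gamma>] that by simp
    then show ?thesis by (simp add: mult_nonneg_nonpos)
  qed
  let ?n = "\<lambda>h. - \<alpha> h"
  have nS: "?n \<in> S" unfolding S_def using neg by (intro CollectI conjI exI[of _ "-1"]) auto
  have n\<alpha>: "?n \<noteq> \<alpha>"
  proof
    assume "?n = \<alpha>"
    then have "- \<alpha> h0 = \<alpha> h0" by (rule fun_cong)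
    then have "2 * \<alpha> h0 = 0" by (simp add: eq_neg_iff_add_eq_0 neg_eq_iff_add_eq_0)
    then show False using h0(2) by simp
  qed
  have in': "i ?n = -1" by (rule ival[OF nS]) simp
  have dU: "dim (U \<alpha>) = 1" using e(2) by (simp add: U_def)
  \<comment> \<open>The term of \<open>\<alpha>\<close> is 1, that of the opposite weight is minus
    the dimension sought, and all others are at most 0. As the total is 0, that dimension is at most
    1.\<close>
  have "(\<Sum>\<gamma>\<in>S. int (dim (U \<gamma>)) * i \<gamma>) = 1 + (\<Sum>\<gamma>\<in>S - {\<alpha>}. int (dim (U \<gamma>)) * i \<gamma>)"
    using sum.remove[OF finS \<alpha>S, of "\<lambda>\<gamma>. int (dim (U \<gamma>)) * i \<gamma>"] dU i\<alpha> by simp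
  also have "(\<Sum>\<gamma>\<in>S - {\<alpha>}. int (dim (U \<gamma>)) * i \<gamma>)
      = - int (dim (U ?n)) + (\<Sum>\<gamma>\<in>S - {\<alpha>} - {?n}. int (dim (U \<gamma>)) * i \<gamma>)"
    using sum.remove[of "S - {\<alpha>}" ?n "\<lambda>\<gamma>. int (dim (U \<gamma>)) * i \<gamma>"] finS nS n\<alpha> in' by simp
  also have "(\<Sum>\<gamma>\<in>S - {\<alpha>} - {?n}. int (dim (U \<gamma>)) * i \<gamma>) \<le> 0"
    by (rule sum_nonpos) (use Sdim in blast)
  finally have "dim (U ?n) \<le> 1" using isum by simp
  then have "dim (wsp ?n) \<le> 1" using n\<alpha> by (simp add: U_def)
  then show ?thesis using dim_weight_pos[OF neg] by simp
qed

lemma dim_nonzero_weight: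
  assumes \<alpha>: "\<alpha> \<in> nonzero_weights" shows "dim (wsp \<alpha>) = 1"
proof -
  have \<alpha>w: "\<alpha> \<in> weights" using \<alpha> by (rule nonzero_weightsD)
  obtain e where e: "e \<in> wsp \<alpha>" "e \<noteq> 0"
    using weight_vector[OF \<alpha>w] by metis
  have "(\<lambda>h. - \<alpha> h) \<in> weights" using opposite_weight[OF \<alpha>w e] by metis
  then have "(\<lambda>h. - \<alpha> h) \<in> nonzero_weights" using \<alpha> by (simp add: nonzero_weights_def)
  from dim_opposite_weight[OF this] show ?thesis by simp
qed

text \<open>A root asks for linearity and a genuine common eigenvector, a weight only for a
  generalized one; the trace formulas and \<open>weight_vector\<close> close the gap.\<close>

lemma roots_eq: "roots smul br H = nonzero_weights"
proof (intro equalityI subsetI)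
  fix \<alpha> assume "\<alpha> \<in> roots smul br H"
  then have \<alpha>: "supp_H \<alpha>" "\<exists>x\<in>H. \<alpha> x \<noteq> 0" "root_space smul br H \<alpha> \<noteq> {0}"
    by (simp_all add: roots_def supp_H_def)
  have "0 \<in> root_space smul br H \<alpha>" by (simp add: root_space_def br_0_right)
  then obtain v where v: "v \<in> root_space smul br H \<alpha>" "v \<noteq> 0" using \<alpha>(3) by blast
  have "v \<in> gen_eig (br h) (\<alpha> h)" if "h \<in> H" for h
  proof -
    have "((\<lambda>v. br h v - smul (\<alpha> h) v) ^^ 1) v = 0" using v(1) that by (simp add: root_space_def)
    then show ?thesis unfolding gen_eig_def by blast
  qed
  then have "v \<in> wsp \<alpha>" by (simp add: wsp_def)
  then show "\<alpha> \<in> nonzero_weights" using \<alpha> v(2) unfolding nonzero_weights_def weights_def by blast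
next
  fix \<alpha> assume \<alpha>: "\<alpha> \<in> nonzero_weights"
  have \<alpha>w: "\<alpha> \<in> weights" using \<alpha> by (rule nonzero_weightsD)
  obtain e where e: "e \<noteq> 0" "\<And>h. h \<in> H \<Longrightarrow> br h e = smul (\<alpha> h) e"
    using weight_vector[OF \<alpha>w] by metis
  then have "e \<in> root_space smul br H \<alpha>" by (simp add: root_space_def)
  then have "root_space smul br H \<alpha> \<noteq> {0}" using e(1) by blast
  then show "\<alpha> \<in> roots smul br H"
    using \<alpha> weights_supp[OF \<alpha>w] weight_add[OF \<alpha>w] weight_scale[OF \<alpha>w]
    by (simp add: roots_def supp_H_def nonzero_weights_def)
qed

end

section \<open>Automorphisms of finite order\<close>

context fd_lie_algebra
begin

definition lie_aut :: "('v \<Rightarrow> 'v) \<Rightarrow> bool" where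
  "lie_aut \<sigma> \<longleftrightarrow> lin \<sigma> \<and> (\<forall>x y. \<sigma> (br x y) = br (\<sigma> x) (\<sigma> y))"

text \<open>Dividing by \<open>k!\<close> removes the binomial coefficients from the Leibniz rule.
  Since \<open>D (E k v)\<close> is \<open>k + 1\<close> times \<open>E (k + 1) v\<close>, the
  coefficients \<open>i\<close> and \<open>n + 1 - i\<close> add up to \<open>n + 1\<close>, which
  cancels in characteristic 0.\<close>

lemma divided_power_leibniz:
  fixes D :: "'v \<Rightarrow> 'v"
  assumes D: "lin D" and der: "\<And>a b. D (br a b) = br (D a) b + br a (D b)"
  defines "E \<equiv> \<lambda>k v. smul (inverse (of_nat (fact k))) ((D ^^ k) v)"
  shows "E n (br a b) = (\<Sum>i\<le>n. br (E i a) (E (n - i) b))"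
proof (induction n)
  case 0
  then show ?case by (simp add: E_def)
next
  case (Suc n)
  have DE: "D (E k v) = smul (of_nat (Suc k)) (E (Suc k) v)" for k v
  proof -
    have "of_nat (Suc k) * inverse (of_nat (fact (Suc k))) = (inverse (of_nat (fact k)) :: 'k)"
      using of_nat_neq_0[of k, where 'a='k]
      by (simp only: fact_Suc of_nat_mult of_nat_id inverse_mult_distrib mult.assoc[symmetric]
          right_inverse mult_1_left not_False_eq_True)
    then show ?thesis by (simp add: E_def lin_scale[OF D] del: of_nat_Suc fact_Suc)
  qed
  let ?g = "\<lambda>i. br (E i a) (E (Suc n - i) b)"
  have "smul (of_nat (Suc n)) (E (Suc n) (br a b)) = D (\<Sum>i\<le>n. br (E i a) (E (n - i) b))"
    unfolding Suc[symmetric] DE ..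
  also have "\<dots> = (\<Sum>i\<le>n. br (D (E i a)) (E (n - i) b)) + (\<Sum>i\<le>n. br (E i a) (D (E (n - i) b)))"
    by (simp add: lin_sum[OF D] der sum.distrib)
  also have "(\<Sum>i\<le>n. br (D (E i a)) (E (n - i) b)) = (\<Sum>i\<le>Suc n. smul (of_nat i) (?g i))"
    unfolding DE br_scale_left sum.atMost_Suc_shift[of _ n] by (simp del: of_nat_Suc)
  also have "(\<Sum>i\<le>n. br (E i a) (D (E (n - i) b))) = (\<Sum>i\<le>Suc n. smul (of_nat (Suc n - i)) (?g i))"
    unfolding DE br_scale_right by (simp add: Suc_diff_le del: of_nat_Suc of_nat_diff)
  also have "(\<Sum>i\<le>Suc n. smul (of_nat i) (?g i)) + (\<Sum>i\<le>Suc n. smul (of_nat (Suc n - i)) (?g i))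
      = (\<Sum>i\<le>Suc n. smul (of_nat (Suc n)) (?g i))"
    unfolding sum.distrib[symmetric] scale_left_distrib[symmetric] of_nat_add[symmetric]
    by (rule sum.cong) auto
  also have "\<dots> = smul (of_nat (Suc n)) (\<Sum>i\<le>Suc n. ?g i)"
    by (rule scale_sum_right[symmetric])
  finally have "smul (of_nat (Suc n)) (E (Suc n) (br a b)) = smul (of_nat (Suc n)) (\<Sum>i\<le>Suc n. ?g i)" .
  moreover have "(of_nat (Suc n) :: 'k) \<noteq> 0" by (rule of_nat_neq_0)
  ultimately show ?case using scale_left_imp_eq by blast
qed

lemma exp_map_aut:
  assumes D: "lin D" and der: "\<And>a b. D (br a b) = br (D a) b + br a (D b)"
    and nil: "nilpotent_map D"
  shows "lie_aut (exp_map smul D)"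
proof -
  define N where "N = (LEAST n. D ^^ n = (\<lambda>_. 0))"
  define E where "E = (\<lambda>k v. smul (inverse (of_nat (fact k))) ((D ^^ k) v))"
  have ex: "exp_map smul D = (\<lambda>v. \<Sum>k<N. E k v)"
    unfolding exp_map_def N_def E_def ..
  have "D ^^ N = (\<lambda>_. 0)"
    unfolding N_def using nil unfolding nilpotent_map_def by (rule LeastI_ex)
  then have N0: "(D ^^ N) v = 0" for v by simp
  have E0: "E k v = 0" if "N \<le> k" for k v
    using funpow_zero_mono[OF D N0 that] by (simp add: E_def)
  have "lin (exp_map smul D)"
    unfolding ex E_def by (intro lin_sum_maps lin_scaled lin_funpow D)
  moreover have "exp_map smul D (br a b) = br (exp_map smul D a) (exp_map smul D b)" for a b
  proof -
    let ?G = "\<lambda>i j. br (E i a) (E j b)"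
    \<comment> \<open>The bound \<open>N + N\<close> adds only zero terms and makes the triangle
      \<open>i + j < N + N\<close> contain the square of side \<open>N\<close>. Outside the square
      one index is at least \<open>N\<close>, so the term vanishes.\<close>
    have "(\<Sum>k<N. E k (br a b)) = (\<Sum>k<N + N. E k (br a b))"
      by (rule sum.mono_neutral_left) (auto simp: E0)
    also have "\<dots> = (\<Sum>k<N + N. \<Sum>i\<le>k. ?G i (k - i))"
      unfolding E_def by (simp only: divided_power_leibniz[OF D der])
    also have "\<dots> = (\<Sum>(i,j)\<in>{(i,j). i + j < N + N}. ?G i j)"
      by (rule sum.triangle_reindex[symmetric])
    also have "\<dots> = (\<Sum>(i,j)\<in>{..<N} \<times> {..<N}. ?G i j)"
    proof (rule sum.mono_neutral_right)
      show "finite {(i, j). i + j < N + N}"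
        by (rule finite_subset[of _ "{..<N + N} \<times> {..<N + N}"]) auto
      show "\<forall>p\<in>{(i, j). i + j < N + N} - {..<N} \<times> {..<N}. (case p of (i, j) \<Rightarrow> ?G i j) = 0"
        by clarsimp (metis E0 br_0_left br_0_right not_less)
    qed auto
    also have "\<dots> = br (\<Sum>i<N. E i a) (\<Sum>j<N. E j b)"
      unfolding sum.cartesian_product[symmetric] lin_sum[OF lin_br_left]
    by (simp only: lin_sum[OF lin_br])
    finally show ?thesis unfolding ex .
  qed
  ultimately show ?thesis unfolding lie_aut_def by blast
qed

lemma adjoint_group_aut: "\<sigma> \<in> adjoint_group smul br \<Longrightarrow> lie_aut \<sigma>"
proof (induction rule: adjoint_group.induct)
  case adj_id
  then show ?case using lin_id by (simp add: lie_aut_def id_def)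
next
  case (adj_step x \<sigma>)
  have "lie_aut (exp_map smul (br x))"
    by (rule exp_map_aut[OF lin_br br_jacobi adj_step.hyps(1)])
  then show ?case
    using adj_step.IH lin_compose[of "exp_map smul (br x)" \<sigma>] by (simp add: lie_aut_def o_def)
qed

lemma lie_aut_funpow: "lie_aut \<sigma> \<Longrightarrow> lie_aut (\<sigma> ^^ n)"
proof (induction n)
  case (Suc n)
  then have "\<sigma> ((\<sigma> ^^ n) (br x y)) = br (\<sigma> ((\<sigma> ^^ n) x)) (\<sigma> ((\<sigma> ^^ n) y))" for x y
    by (simp add: lie_aut_def)
  then show ?case using Suc.prems lin_funpow[of \<sigma> "Suc n"] by (simp add: lie_aut_def o_def)
qed (use lin_id in \<open>simp add: lie_aut_def id_def\<close>)

lemma trace_average: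
  assumes V: "subspace V" and \<sigma>: "lin \<sigma>" "\<And>v. v \<in> V \<Longrightarrow> \<sigma> v \<in> V"
    and m: "m > 0" "\<And>v. (\<sigma> ^^ m) v = v"
  shows "(\<Sum>s<m. trace V (\<sigma> ^^ s)) = of_nat (m * dim {v \<in> V. \<sigma> v = v})"
proof -
  let ?F = "{v \<in> V. \<sigma> v = v}"
  let ?P = "\<lambda>v. \<Sum>s<m. (\<sigma> ^^ s) v"
  have F: "subspace ?F"
    using V by (intro subspaceI)
      (simp_all add: lin_zero[OF \<sigma>(1)] lin_add[OF \<sigma>(1)] lin_scale[OF \<sigma>(1)] subspace_0 subspace_add
        subspace_scale)
  have m0: "(of_nat m :: 'k) \<noteq> 0" using m(1) by simp
  have P: "lin ?P" by (intro lin_sum_maps lin_funpow \<sigma>)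
  have PV: "?P v \<in> V" if "v \<in> V" for v
    by (intro subspace_sum[OF V] funpow_inv[OF \<sigma>(2) that])
  have P\<sigma>: "\<sigma> (?P v) = ?P v" for v
  proof -
    \<comment> \<open>Applying \<open>\<sigma>\<close> shifts the sum cyclically, because the
      iterates of index 0 and \<open>m\<close> agree.\<close>
    have "\<sigma> (?P v) = (\<Sum>s<m. (\<sigma> ^^ Suc s) v)" by (simp add: lin_sum[OF \<sigma>(1)])
    moreover have "v + (\<Sum>s<m. (\<sigma> ^^ Suc s) v) = (\<Sum>s<Suc m. (\<sigma> ^^ s) v)"
      unfolding sum.lessThan_Suc_shift by simp
    moreover have "\<dots> = ?P v + v" by (simp add: m(2))
    ultimately show ?thesis by simp
  qed
  have Pfix: "?P v = smul (of_nat m) v" if "\<sigma> v = v" for v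
  proof -
    have "(\<sigma> ^^ s) v = v" for s by (induction s) (simp_all add: that)
    then show ?thesis by (simp add: sum_constant_scale)
  qed
  have "(\<Sum>s<m. trace V (\<sigma> ^^ s)) = trace V ?P"
    by (rule trace_sum[symmetric, OF V]) (simp_all add: lin_funpow[OF \<sigma>(1)] funpow_inv[OF \<sigma>(2)])
  also have "\<dots> = trace V (\<lambda>v. smul (of_nat m) (smul (inverse (of_nat m)) (?P v)))"
    using m0 by simp
  also have "\<dots> = of_nat m * trace V (\<lambda>v. smul (inverse (of_nat m)) (?P v))"
    by (rule trace_scaled[OF V lin_scaled[OF P]]) (intro subspace_scale[OF V] PV)
  also have "trace V (\<lambda>v. smul (inverse (of_nat m)) (?P v)) = of_nat (dim ?F)"
  proof (rule trace_projection[OF V lin_scaled[OF P] F])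
    show "smul (inverse (of_nat m)) (?P v) \<in> ?F" if "v \<in> V" for v
      using PV[OF that] by (simp add: subspace_scale[OF V] lin_scale[OF \<sigma>(1)] P\<sigma>)
    show "smul (inverse (of_nat m)) (?P v) = v" if "v \<in> ?F" for v
      using Pfix[of v] that m0 by simp
  qed blast
  finally show ?thesis by simp
qed

end

section \<open>Permutation of the root lines and the trace count\<close>

context simple_cartan
begin

lemma finite_nonzero_weights: "finite nonzero_weights"
  using finite_weights nonzero_weightsD by (meson finite_subset subsetI)

lemma wsp_nonzero_weight:
  assumes "\<alpha> \<in> nonzero_weights" "e \<in> wsp \<alpha>" "e \<noteq> 0"
  shows "wsp \<alpha> = span {e}"
proof -
  have "span {e} \<subseteq> wsp \<alpha>" by (rule span_minimal) (use assms(2) subspace_wsp in auto)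
  moreover have "dim (wsp \<alpha>) \<le> dim (span {e})"
    using dim_nonzero_weight[OF assms(1)] assms(3) by simp
  ultimately have "span {e} = wsp \<alpha>"
    by (intro subspace_dim_equal subspace_span subspace_wsp)
  then show ?thesis by simp
qed

lemma H_root_sum:
  defines "W \<equiv> span (\<Union>\<gamma>\<in>nonzero_weights. wsp \<gamma>)"
  shows "H \<inter> W = {0}" "span (H \<union> W) = UNIV"
proof -
  have "v = 0" if v: "v \<in> H" "v \<in> W" for v
  proof (rule wsp_disjoint[OF finite_nonzero_weights])
    show "supp_H \<gamma>" if "\<gamma> \<in> nonzero_weights" for \<gamma>
      using that nonzero_weightsD weights_supp by blast
    show "v \<in> wsp (\<lambda>_. 0)" using v(1) wsp_0 by simp
    show "v \<in> span (\<Union>\<gamma>\<in>nonzero_weights. wsp \<gamma>)" using v(2) by (simp add: W_def)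
  qed (simp_all add: supp_H_def nonzero_weights_def)
  then show "H \<inter> W = {0}" using subspace_0[OF subspace_H] span_zero unfolding W_def by blast
  have "wsp \<gamma> \<subseteq> H \<union> W" if \<gamma>: "\<gamma> \<in> weights" for \<gamma>
  proof (cases "\<gamma> \<in> nonzero_weights")
    case True
    then have "wsp \<gamma> \<subseteq> W" unfolding W_def by (intro subsetI span_base) blast
    then show ?thesis by blast
  next
    case False
    then have "wsp \<gamma> = wsp (\<lambda>_. 0)" using \<gamma> by (intro wsp_cong) (auto simp: nonzero_weights_def)
    then show ?thesis by (simp add: wsp_0)
  qed
  then have "span (\<Union>\<gamma>\<in>weights. wsp \<gamma>) \<subseteq> span (H \<union> W)" by (intro span_mono) blast
  then show "span (H \<union> W) = UNIV" using span_weights by blast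
qed

text \<open>In a basis of root vectors the powers of the lift have monomial matrices, so their
  diagonals can be read off.\<close>

lemma root_vectors_basis:
  assumes E: "\<And>\<gamma>. \<gamma> \<in> nonzero_weights \<Longrightarrow> E \<gamma> \<in> wsp \<gamma> \<and> E \<gamma> \<noteq> 0"
  shows "inj_on E nonzero_weights"
    and "basis_of (E ` nonzero_weights) (span (\<Union>\<gamma>\<in>nonzero_weights. wsp \<gamma>))"
proof -
  have sup: "supp_H \<gamma>" if "\<gamma> \<in> nonzero_weights" for \<gamma>
    using that nonzero_weightsD weights_supp by blast
  have "independent (E ` S) \<and> inj_on E S" if "finite S" "S \<subseteq> nonzero_weights" for S
    using that
  proof (induction S rule: finite_induct)
    case (insert \<gamma> S)
    have "E ` S \<subseteq> (\<Union>\<gamma>\<in>S. wsp \<gamma>)" using E insert.prems by blast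
    then have "span (E ` S) \<subseteq> span (\<Union>\<gamma>\<in>S. wsp \<gamma>)" by (rule span_mono)
    then have n: "E \<gamma> \<notin> span (E ` S)"
      using wsp_disjoint[of S \<gamma> "E \<gamma>"] insert.hyps insert.prems E sup by blast
    then have "E \<gamma> \<notin> E ` S" using span_base[of "E \<gamma>" "E ` S"] by blast
    moreover have "independent (E ` S)" "inj_on E S" using insert.IH insert.prems by blast+
    ultimately show ?case using independent_insertI[OF n] insert.hyps(2) by simp
  qed (simp add: independent_empty)
  from this[OF finite_nonzero_weights subset_refl]
  have *: "independent (E ` nonzero_weights)" "inj_on E nonzero_weights" by blast+
  show "inj_on E nonzero_weights" by (rule *(2))
  have "span (\<Union>\<gamma>\<in>nonzero_weights. wsp \<gamma>) \<subseteq> span (E ` nonzero_weights)"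
  proof (rule span_minimal[OF _ subspace_span])
    show "(\<Union>\<gamma>\<in>nonzero_weights. wsp \<gamma>) \<subseteq> span (E ` nonzero_weights)"
    proof
      fix v assume "v \<in> (\<Union>\<gamma>\<in>nonzero_weights. wsp \<gamma>)"
      then obtain \<gamma> where \<gamma>: "\<gamma> \<in> nonzero_weights" "v \<in> wsp \<gamma>" by blast
      then have "v \<in> span {E \<gamma>}" using wsp_nonzero_weight[OF \<gamma>(1)] E[OF \<gamma>(1)] by simp
      moreover have "span {E \<gamma>} \<subseteq> span (E ` nonzero_weights)"
        by (rule span_mono) (use \<gamma>(1) in blast)
      ultimately show "v \<in> span (E ` nonzero_weights)" by blast
    qed
  qed
  moreover have "span (E ` nonzero_weights) \<subseteq> span (\<Union>\<gamma>\<in>nonzero_weights. wsp \<gamma>)"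
    by (rule span_mono) (use E in blast)
  ultimately show "basis_of (E ` nonzero_weights) (span (\<Union>\<gamma>\<in>nonzero_weights. wsp \<gamma>))"
    using *(1) unfolding basis_of_def by blast
qed

lemma restr_H_funpow:
  assumes "\<sigma> ` H = H"
  shows "(restr_H H \<sigma> ^^ n) x = (if x \<in> H then (\<sigma> ^^ n) x else x)"
proof (cases "x \<in> H")
  case True
  have "(\<sigma> ^^ n) x \<in> H" for n by (induction n) (use True assms in auto)
  then have "(restr_H H \<sigma> ^^ n) x = (\<sigma> ^^ n) x" by (induction n) (simp_all add: restr_H_def)
  then show ?thesis using True by simp
next
  case False
  then show ?thesis by (induction n) (simp_all add: restr_H_def)
qed

text \<open>Averaging turns each fixed-space dimension, multiplied by \<open>m\<close>, into a sum
  of traces. The resulting equality holds in the field and comes back to the natural numbers by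
  characteristic 0.\<close>

lemma fixed_space_dimension:
  assumes \<sigma>: "lie_aut \<sigma>" and \<sigma>H: "\<sigma> ` H = H" and m: "m > 0" "\<sigma> ^^ m = id"
    and free: "\<And>s \<alpha>. 0 < s \<Longrightarrow> s < m \<Longrightarrow> \<alpha> \<in> nonzero_weights \<Longrightarrow> \<alpha> \<circ> (restr_H H \<sigma> ^^ s) \<noteq> \<alpha>"
  shows "m * dim {x. \<sigma> x = x} = m * dim {x \<in> H. \<sigma> x = x} + card nonzero_weights"
proof -
  define W where "W = span (\<Union>\<gamma>\<in>nonzero_weights. wsp \<gamma>)"
  have sW: "subspace W" unfolding W_def by (rule subspace_span)
  have l: "lin \<sigma>" using \<sigma> by (simp add: lie_aut_def)
  have "\<exists>E. \<forall>\<gamma>\<in>nonzero_weights. E \<gamma> \<in> wsp \<gamma> \<and> E \<gamma> \<noteq> 0 \<and> (\<forall>h\<in>H. br h (E \<gamma>) = smul (\<gamma> h) (E \<gamma>))"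
    by (intro bchoice) (metis weight_vector nonzero_weightsD)
  then obtain E where E: "\<And>\<gamma>. \<gamma> \<in> nonzero_weights \<Longrightarrow> E \<gamma> \<in> wsp \<gamma> \<and> E \<gamma> \<noteq> 0"
    and EH: "\<And>\<gamma> h. \<gamma> \<in> nonzero_weights \<Longrightarrow> h \<in> H \<Longrightarrow> br h (E \<gamma>) = smul (\<gamma> h) (E \<gamma>)"
    by blast
  note inj = root_vectors_basis(1)[of E, OF E]
  have B: "basis_of (E ` nonzero_weights) W"
    unfolding W_def using root_vectors_basis(2)[of E, OF E] .
  have Hs: "(\<sigma> ^^ s) h \<in> H" if "h \<in> H" for s h
    by (rule funpow_inv) (use \<sigma>H that in auto)
  have comp: "(\<sigma> ^^ s) ((\<sigma> ^^ (m - s)) v) = v" "(\<sigma> ^^ (m - s)) ((\<sigma> ^^ s) v) = v" if "s \<le> m" for s v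
    using that m(2) by (simp_all flip: comp_apply[of "_ ^^ _"] funpow_add)
  \<comment> \<open>With \<open>w\<close> the restriction of \<open>\<sigma>\<close> to
    \<open>H\<close>, the power \<open>\<sigma>^s\<close> carries weight \<open>\<gamma>\<close> to
    \<open>\<gamma>\<close> composed with the inverse of \<open>w^s\<close>; finite order lets that
    inverse be written with exponent \<open>m - s\<close>.\<close>
  have perm: "\<gamma> \<circ> (restr_H H \<sigma> ^^ (m - s)) \<in> nonzero_weights \<and>
      (\<exists>c. (\<sigma> ^^ s) (E \<gamma>) = smul c (E (\<gamma> \<circ> (restr_H H \<sigma> ^^ (m - s)))))"
    if s: "s \<le> m" and \<gamma>: "\<gamma> \<in> nonzero_weights" for s \<gamma>
  proof -
    let ?\<delta> = "\<gamma> \<circ> (restr_H H \<sigma> ^^ (m - s))"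
    let ?v = "(\<sigma> ^^ s) (E \<gamma>)"
    have aut: "lie_aut (\<sigma> ^^ s)" by (rule lie_aut_funpow[OF \<sigma>])
    \<comment> \<open>Outside \<open>H\<close> the map \<open>restr_H H \<sigma>\<close> is the
      identity and \<open>\<gamma>\<close> is 0, so the new function still satisfies the support
      condition.\<close>
    have \<delta>: "?\<delta> h = (if h \<in> H then \<gamma> ((\<sigma> ^^ (m - s)) h) else 0)" for h
      using weights_supp[OF nonzero_weightsD[OF \<gamma>]] by (simp add: restr_H_funpow[OF \<sigma>H] supp_H_def)
    have eig: "br h ?v = smul (?\<delta> h) ?v" if h: "h \<in> H" for h
    proof -
      have "br h ?v = (\<sigma> ^^ s) (br ((\<sigma> ^^ (m - s)) h) (E \<gamma>))"
        using aut comp(1)[OF s, of h] by (simp add: lie_aut_def)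
      also have "\<dots> = (\<sigma> ^^ s) (smul (?\<delta> h) (E \<gamma>))"
        using EH[OF \<gamma> Hs[OF h]] h unfolding \<delta> by simp
      finally show ?thesis using aut by (simp add: lie_aut_def lin_scale)
    qed
    have v0: "?v \<noteq> 0"
    proof
      assume "?v = 0"
      then have "(\<sigma> ^^ (m - s)) 0 = E \<gamma>" using comp(2)[OF s, of "E \<gamma>"] by simp
      then show False using E[OF \<gamma>] lin_zero[OF lin_funpow[OF l]] by simp
    qed
    have vw: "?v \<in> wsp ?\<delta>"
    proof -
      have "?v \<in> gen_eig (br h) (?\<delta> h)" if "h \<in> H" for h
      proof -
        have "((\<lambda>v. br h v - smul (?\<delta> h) v) ^^ 1) ?v = 0" using eig[OF that] by simp
        then show ?thesis unfolding gen_eig_def by blast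
      qed
      then show ?thesis by (simp add: wsp_def)
    qed
    have "supp_H ?\<delta>" unfolding supp_H_def \<delta> by simp
    then have w: "?\<delta> \<in> weights" using vw v0 unfolding weights_def by blast
    obtain h0 where h0: "h0 \<in> H" "\<gamma> h0 \<noteq> 0" using \<gamma> unfolding nonzero_weights_def by blast
    have "?\<delta> ((\<sigma> ^^ s) h0) = \<gamma> h0" unfolding \<delta> using Hs[OF h0(1)] comp(2)[OF s] by simp
    then have nz: "?\<delta> \<in> nonzero_weights"
      using w Hs[OF h0(1)] h0(2) unfolding nonzero_weights_def by (metis (mono_tags, lifting) mem_Collect_eq)
    then have "?v \<in> span {E ?\<delta>}" using vw wsp_nonzero_weight[OF nz] E[OF nz] by blast
    then show ?thesis using nz by (auto simp: span_singleton)
  qed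
  have Ws: "(\<sigma> ^^ s) v \<in> W" if s: "s \<le> m" and v: "v \<in> W" for s v
  proof (rule lin_span_into[OF lin_funpow[OF l] _ sW])
    show "v \<in> span (E ` nonzero_weights)" using v B by (simp add: basis_of_def)
    fix x assume "x \<in> E ` nonzero_weights"
    then obtain \<gamma> where \<gamma>: "\<gamma> \<in> nonzero_weights" "x = E \<gamma>" by blast
    obtain c where c: "(\<sigma> ^^ s) x = smul c (E (\<gamma> \<circ> (restr_H H \<sigma> ^^ (m - s))))"
      and nz: "\<gamma> \<circ> (restr_H H \<sigma> ^^ (m - s)) \<in> nonzero_weights"
      using perm[OF s \<gamma>(1)] \<gamma>(2) by blast
    have "E (\<gamma> \<circ> (restr_H H \<sigma> ^^ (m - s))) \<in> W" using basis_of_subset[OF B] nz by blast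
    then show "(\<sigma> ^^ s) x \<in> W" unfolding c by (rule subspace_scale[OF sW])
  qed
  have tr0: "trace W (\<sigma> ^^ s) = 0" if s: "0 < s" "s < m" for s
  proof -
    have sm: "s \<le> m" using s by simp
    have ind: "independent (E ` nonzero_weights)" using B by (simp add: basis_of_def)
    have "representation (E ` nonzero_weights) ((\<sigma> ^^ s) b) b = 0" if b: "b \<in> E ` nonzero_weights" for b
    proof -
      obtain \<gamma> where \<gamma>: "\<gamma> \<in> nonzero_weights" "b = E \<gamma>" using b by blast
      let ?\<delta> = "\<gamma> \<circ> (restr_H H \<sigma> ^^ (m - s))"
      obtain c where c: "(\<sigma> ^^ s) b = smul c (E ?\<delta>)" and nz: "?\<delta> \<in> nonzero_weights"
        using perm[OF sm \<gamma>(1)] \<gamma>(2) by blast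
      \<comment> \<open>The exponent \<open>m - s\<close> also lies strictly between 0 and
        \<open>m\<close>, so \<open>free\<close> applies to it.\<close>
      have "?\<delta> \<noteq> \<gamma>" using s by (intro free \<gamma>(1)) simp_all
      then have "E ?\<delta> \<noteq> b" using inj nz \<gamma> unfolding inj_on_def by blast
      moreover have "E ?\<delta> \<in> E ` nonzero_weights" using nz by blast
      ultimately show ?thesis
        unfolding c by (simp add: representation_scale[OF ind span_base] representation_basis[OF ind])
    qed
    then show ?thesis
      by (subst trace_basis[OF B lin_funpow[OF l] Ws[OF sm]]) simp_all
  qed
  have "trace W (\<sigma> ^^ 0) = trace W (\<lambda>v. smul 1 v)" by (rule trace_cong[OF sW]) simp
  also have "\<dots> = of_nat (card nonzero_weights)"
    using trace_scalar[OF sW, of 1] basis_of_card[OF B] card_image[OF inj] by simp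
  finally have tr1: "trace W (\<sigma> ^^ 0) = of_nat (card nonzero_weights)" .
  have "(\<Sum>s<m. trace W (\<sigma> ^^ s)) = (\<Sum>s\<in>{0}. trace W (\<sigma> ^^ s))"
    by (rule sum.mono_neutral_right) (use m tr0 in auto)
  then have trW: "(\<Sum>s<m. trace W (\<sigma> ^^ s)) = of_nat (card nonzero_weights)" using tr1 by simp
  have split: "trace UNIV (\<sigma> ^^ s) = trace H (\<sigma> ^^ s) + trace W (\<sigma> ^^ s)" if "s < m" for s
  proof -
    have "trace (span (H \<union> W)) (\<sigma> ^^ s) = trace H (\<sigma> ^^ s) + trace W (\<sigma> ^^ s)"
      by (rule trace_direct_sum[OF subspace_H sW _ lin_funpow[OF l] Hs Ws])
        (use H_root_sum(1) that in \<open>simp_all add: W_def\<close>)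
    moreover have "span (H \<union> W) = UNIV" unfolding W_def by (rule H_root_sum(2))
    ultimately show ?thesis by simp
  qed
  have fix_m: "(\<sigma> ^^ m) v = v" for v using m(2) by simp
  have "(of_nat (m * dim {x \<in> UNIV. \<sigma> x = x}) :: 'k) = (\<Sum>s<m. trace UNIV (\<sigma> ^^ s))"
    by (rule trace_average[OF subspace_UNIV l _ m(1) fix_m, symmetric]) simp
  also have "\<dots> = (\<Sum>s<m. trace H (\<sigma> ^^ s)) + (\<Sum>s<m. trace W (\<sigma> ^^ s))"
    by (simp add: split sum.distrib)
  also have "(\<Sum>s<m. trace H (\<sigma> ^^ s)) = of_nat (m * dim {x \<in> H. \<sigma> x = x})"
    by (rule trace_average[OF subspace_H l _ m(1) fix_m]) (use \<sigma>H in blast)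
  finally have "(of_nat (m * dim {x \<in> UNIV. \<sigma> x = x}) :: 'k)
      = of_nat (m * dim {x \<in> H. \<sigma> x = x} + card nonzero_weights)"
    unfolding trW by simp
  then have "m * dim {x \<in> UNIV. \<sigma> x = x} = m * dim {x \<in> H. \<sigma> x = x} + card nonzero_weights"
    by (simp only: of_nat_eq_iff)
  then show ?thesis by simp
qed

end

text \<open>Quasiregularity speaks only of divisors of the order. Bezout's identity
  \<open>s * x = m * y + gcd s m\<close> passes from an arbitrary exponent to a divisor, as
  \<open>w^(m * y)\<close> is the identity.\<close>

lemma funpow_stable_gcd:
  assumes "\<alpha> \<circ> (w ^^ s) = \<alpha>" "w ^^ m = id" "s > 0"
  shows "\<alpha> \<circ> (w ^^ gcd s m) = \<alpha>"
proof -
  obtain x y where xy: "s * x = m * y + gcd s m" using bezout_nat[of s m] assms(3) by auto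
  have "\<alpha> \<circ> (w ^^ (s * k)) = \<alpha>" for k
  proof (induction k)
    case (Suc k)
    have "\<alpha> \<circ> (w ^^ (s * Suc k)) = (\<alpha> \<circ> (w ^^ s)) \<circ> (w ^^ (s * k))"
      by (simp add: funpow_add o_assoc)
    then show ?case using Suc assms(1) by simp
  qed simp
  moreover have "w ^^ (m * y) = id" by (simp add: funpow_mult[symmetric] assms(2))
  ultimately show ?thesis
    by (metis xy funpow_add comp_id id_comp)
qed

theorem theorem7p6:
  fixes smul :: "'k::field_char_0 \<Rightarrow> 'v::ab_group_add \<Rightarrow> 'v"
    and br :: "'v \<Rightarrow> 'v \<Rightarrow> 'v"
    and H :: "'v set"
    and w \<sigma> :: "'v \<Rightarrow> 'v"
    and m :: nat
  assumes "alg_closed_field TYPE('k)"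
    and "fin_dim smul"
    and "simple_lie_algebra smul br"
    and "cartan_subalgebra smul br H"
    and "w \<in> weyl_group smul br H"
    and "has_order w m"
    and "quasiregular smul br H w m"
    and "is_lift smul br H w \<sigma>"
    and "has_order \<sigma> m"
  shows "(of_nat (card (roots smul br H)) / of_nat m :: rat) =
           of_nat (vector_space.dim smul {x. \<sigma> x = x})
         - of_nat (vector_space.dim smul {x \<in> H. w x = x})"
proof -
  have lie: "lie_algebra smul br" using assms(3) by (simp add: simple_lie_algebra_def)
  then interpret vector_space smul by (simp add: lie_algebra_def)
  \<comment> \<open>\<open>fin_dim\<close> supplies a finite spanning set, whereas the locale asks
    for a finite basis; a maximal independent subset is one.\<close>
  obtain A where A: "finite A" "span A = UNIV" using assms(2) by (auto simp: fin_dim_def)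
  obtain B where B: "B \<subseteq> A" "independent B" "A \<subseteq> span B" by (rule maximal_independent_subset)
  have "span A \<subseteq> span B" using B(3) by (rule span_minimal) (rule subspace_span)
  then have "span B = UNIV" using A(2) by blast
  then interpret simple_cartan smul B br H
    using finite_subset[OF B(1) A(1)] B(2) lie assms(1,3,4)
    by unfold_locales (simp_all add: cartan_subalgebra_def)
  have lift: "\<sigma> \<in> adjoint_group smul br" "\<sigma> ` H = H" "w = restr_H H \<sigma>"
    using assms(8) by (auto simp: is_lift_def normalizer_adj_def)
  have m: "m > 0" "\<sigma> ^^ m = id" "w ^^ m = id"
    using assms(6,9) by (simp_all add: has_order_def)
  have "m * dim {x. \<sigma> x = x} = m * dim {x \<in> H. \<sigma> x = x} + card nonzero_weights"
  proof (rule fixed_space_dimension[OF adjoint_group_aut[OF lift(1)] lift(2) m(1,2)])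
    fix s \<alpha> assume s: "0 < s" "s < m" and \<alpha>: "\<alpha> \<in> nonzero_weights"
    \<comment> \<open>Being at most \<open>s\<close>, this divisor of \<open>m\<close> is proper, as
      quasiregularity requires.\<close>
    have "gcd s m \<le> s" using s(1) by (intro gcd_le1_nat) simp
    then have "gcd s m dvd m" "gcd s m < m" using s(2) by simp_all
    then have "\<alpha> \<circ> (w ^^ gcd s m) \<noteq> \<alpha>"
      using assms(7) \<alpha> roots_eq unfolding quasiregular_def by blast
    then show "\<alpha> \<circ> (restr_H H \<sigma> ^^ s) \<noteq> \<alpha>"
      using funpow_stable_gcd[OF _ m(3) s(1)] lift(3) by blast
  qed
  moreover have "{x \<in> H. w x = x} = {x \<in> H. \<sigma> x = x}" by (auto simp: lift(3) restr_H_def)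
  ultimately have "m * dim {x. \<sigma> x = x} = m * dim {x \<in> H. w x = x} + card (roots smul br H)"
    by (simp add: roots_eq)
  from arg_cong[OF this, of "of_nat :: nat \<Rightarrow> rat"]
  have "(of_nat m * of_nat (dim {x. \<sigma> x = x}) :: rat)
      = of_nat m * of_nat (dim {x \<in> H. w x = x}) + of_nat (card (roots smul br H))"
    by (simp only: of_nat_add of_nat_mult)
  then show ?thesis using m(1) by (simp add: field_simps)
qed

end
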